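(* Let $G$ be a nilpotent $U_{0,r}$-group. If $H<G$ is a proper definable subgroup, then $U_{0,r}(N_G(H)/H)$ is nontrivial.
   Context: "Definable" means definable in the ambient structure of finite Morley rank; $\mathrm{rk}$ denotes Morley rank. Quotients of groups of finite Morley rank by definable normal subgroups are regarded as groups of finite Morley rank with the induced structure. A group of finite Morley rank is connected if it has no proper definable subgroup of finite index. The symbol $<$ denotes proper containment of subgroups. An abelian group $A$ of finite Morley rank is indecomposable if there are no two proper definable subgroups $A_1,A_2<A$ with $A_1+A_2=A$. For a nontrivial definable abelian group $A$, a definable supplement of a subgroup $B\le A$ is a proper definable subgroup $C<A$ with $B+C=A$; the radical $J(A)$ is the (unique) maximal proper definable connected subgroup of $A$ without a definable supplement in $A$. The reduced rank of $A$ is $\bar r(A)=\mathrm{rk}(A/J(A))$. For a group $G$ of finite Morley rank and an integer $r$, $U_{0,r}(G)$ is the subgroup generated by all definable indecomposable abelian subgroups $A\le G$ with $\bar r(A)=r$ and $A/J(A)$ torsion-free. A $U_{0,r}$-group is a group $G$ of finite Morley rank with $U_{0,r}(G)=G$. *)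

theory Defs
  imports "HOL-Algebra.Generated_Groups" "HOL-Algebra.Group_Action" "HOL-Library.Disjoint_Sets"
begin

section \<open>First-order structures and Morley rank\<close>

text \<open>Languages are relational (functions are represented by their graphs, constants by
  unary relations, which changes neither the definable sets nor the elementary extensions).
  A relation is a set of lists; a relation symbol may be used at any arity.\<close>

record ('a, 'r) fo_structure =
  universe :: "'a set"
  interp :: "'r \<Rightarrow> 'a list set"

datatype 'r fm =
    Rel 'r "nat list"
  | Eq nat nat
  | Neg "'r fm"
  | Conj "'r fm" "'r fm"
  | Ex nat "'r fm"

primrec sat :: "('a, 'r) fo_structure \<Rightarrow> 'r fm \<Rightarrow> (nat \<Rightarrow> 'a) \<Rightarrow> bool" where
  "sat M (Rel R is) v \<longleftrightarrow> map v is \<in> interp M R"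
| "sat M (Eq i j) v \<longleftrightarrow> v i = v j"
| "sat M (Neg \<phi>) v \<longleftrightarrow> \<not> sat M \<phi> v"
| "sat M (Conj \<phi> \<psi>) v \<longleftrightarrow> sat M \<phi> v \<and> sat M \<psi> v"
| "sat M (Ex i \<phi>) v \<longleftrightarrow> (\<exists>a\<in>universe M. sat M \<phi> (v(i := a)))"

text \<open>The subset of the \<open>k\<close>-th power of the universe defined by \<open>\<phi>\<close>: the variables
  below \<open>k\<close> are the free ones, the remaining ones are parameters with values given by \<open>v\<close>.\<close>

definition defined_set ::
    "('a, 'r) fo_structure \<Rightarrow> nat \<Rightarrow> 'r fm \<Rightarrow> (nat \<Rightarrow> 'a) \<Rightarrow> 'a list set" where
  "defined_set M k \<phi> v =
     {xs. length xs = k \<and> set xs \<subseteq> universe M \<and> sat M \<phi> (\<lambda>i. if i < k then xs ! i else v i)}"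

definition definable :: "('a, 'r) fo_structure \<Rightarrow> nat \<Rightarrow> 'a list set \<Rightarrow> bool" where
  "definable M k T \<longleftrightarrow> (\<exists>\<phi> v. range v \<subseteq> universe M \<and> T = defined_set M k \<phi> v)"

definition elementary_extension ::
    "('a, 'r) fo_structure \<Rightarrow> ('a, 'r) fo_structure \<Rightarrow> bool" where
  "elementary_extension M N \<longleftrightarrow>
     universe M \<noteq> {} \<and> universe M \<subseteq> universe N \<and>
     (\<forall>\<phi> v. range v \<subseteq> universe M \<longrightarrow> (sat M \<phi> v \<longleftrightarrow> sat N \<phi> v))"

text \<open>Every set of formulas in the variable \<open>0\<close> over finitely many parameters which is
  finitely satisfiable is realized.\<close>

definition omega_saturated :: "('a, 'r) fo_structure \<Rightarrow> bool" where
  "omega_saturated N \<longleftrightarrow>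
     (\<forall>\<Phi> v. range v \<subseteq> universe N \<and> finite (range v) \<and>
        (\<forall>\<Psi>. \<Psi> \<subseteq> \<Phi> \<and> finite \<Psi> \<longrightarrow> (\<exists>a\<in>universe N. \<forall>\<phi>\<in>\<Psi>. sat N \<phi> (v(0 := a))))
      \<longrightarrow> (\<exists>a\<in>universe N. \<forall>\<phi>\<in>\<Phi>. sat N \<phi> (v(0 := a))))"

text \<open>The set \<open>T(N)\<close> defined in the elementary extension \<open>N\<close> by any formula
  with parameters in \<open>M\<close> that defines \<open>T\<close> in \<open>M\<close>.\<close>

definition realization ::
    "('a, 'r) fo_structure \<Rightarrow> ('a, 'r) fo_structure \<Rightarrow> nat \<Rightarrow> 'a list set \<Rightarrow> 'a list set" where
  "realization M N k T =
     (THE T'. \<exists>\<phi> v. range v \<subseteq> universe M \<and> T = defined_set M k \<phi> v \<and> T' = defined_set N k \<phi> v)"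

text \<open>\<open>morley_ge N E n Z\<close>: the Morley rank of \<open>Z/E\<close>, computed in \<open>N\<close>, is at least \<open>n\<close>,
  where \<open>E\<close> is a definable equivalence relation (as a set of lists of length two) and \<open>Z\<close> a
  set of lists of length one which is a union of \<open>E\<close>-classes.  Definable subsets of \<open>Z/E\<close>
  are identified with the \<open>E\<close>-closed definable subsets of \<open>Z\<close>.\<close>

primrec morley_ge ::
    "('a, 'r) fo_structure \<Rightarrow> 'a list set \<Rightarrow> nat \<Rightarrow> 'a list set \<Rightarrow> bool" where
  "morley_ge N E 0 Z \<longleftrightarrow> Z \<noteq> {}"
| "morley_ge N E (Suc n) Z \<longleftrightarrow>
     (\<exists>Y :: nat \<Rightarrow> 'a list set. disjoint_family Y \<and>
        (\<forall>i. definable N 1 (Y i) \<and> Y i \<subseteq> Z \<and>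
             (\<forall>x y. [x] \<in> Y i \<and> [x, y] \<in> E \<longrightarrow> [y] \<in> Y i) \<and>
             morley_ge N E n (Y i)))"


section \<open>Groups of finite Morley rank\<close>

text \<open>The definable structure carried by a set \<open>C\<close> of elements of type \<open>'c\<close>: an ambient
  first-order structure \<open>base\<close>, an \<open>\<omega>\<close>-saturated elementary extension \<open>ext\<close> in which Morley
  rank is computed (the result does not depend on its choice), and a partial map \<open>pres\<close>
  from the universe of \<open>base\<close> onto \<open>C\<close> which presents \<open>C\<close> as a definable set
  modulo a definable equivalence relation.  A group with additional first-order structure is
  the case where \<open>pres\<close> is the identity on the universe; other maps are needed for quotients.\<close>

record ('a, 'r, 'c) induced_structure =
  base :: "('a, 'r) fo_structure"
  ext :: "('a, 'r) fo_structure"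
  pres :: "'a \<Rightarrow> 'c option"

definition pres_kernel :: "('a, 'r, 'c) induced_structure \<Rightarrow> 'a list set" where
  "pres_kernel S = {[x, y] | x y. pres S x \<noteq> None \<and> pres S x = pres S y}"

definition def_set :: "('a, 'r, 'c) induced_structure \<Rightarrow> 'c set \<Rightarrow> bool" where
  "def_set S X \<longleftrightarrow>
     X \<subseteq> ran (pres S) \<and> definable (base S) 1 {[x] | x. pres S x \<in> Some ` X}"

definition rank_ge :: "('a, 'r, 'c) induced_structure \<Rightarrow> nat \<Rightarrow> bool" where
  "rank_ge S n \<longleftrightarrow>
     morley_ge (ext S) (realization (base S) (ext S) 2 (pres_kernel S)) n
       (realization (base S) (ext S) 1 {[x] | x. x \<in> dom (pres S)})"

text \<open>The Morley rank of the whole presented set; meaningful when this set is nonempty and its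
  rank is finite.\<close>

definition morley_rank :: "('a, 'r, 'c) induced_structure \<Rightarrow> nat" where
  "morley_rank S = (GREATEST n. rank_ge S n)"

definition fmr_group ::
    "('a, 'r, 'c) induced_structure \<Rightarrow> ('c, 'm) monoid_scheme \<Rightarrow> bool" where
  "fmr_group S G \<longleftrightarrow>
     group G \<and>
     elementary_extension (base S) (ext S) \<and> omega_saturated (ext S) \<and>
     dom (pres S) \<subseteq> universe (base S) \<and> ran (pres S) = carrier G \<and>
     definable (base S) 1 {[x] | x. x \<in> dom (pres S)} \<and>
     definable (base S) 2 (pres_kernel S) \<and>
     definable (base S) 3
       {[x, y, z] | x y z. \<exists>a b. pres S x = Some a \<and> pres S y = Some b \<and>
                              pres S z = Some (a \<otimes>\<^bsub>G\<^esub> b)} \<and>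
     (\<exists>n. \<not> rank_ge S n)"

text \<open>The induced structure on the quotient \<open>A/K\<close> of a definable subgroup \<open>A\<close> of \<open>G\<close>
  by a definable normal subgroup \<open>K\<close> of \<open>A\<close>, i.e. on the group \<open>G\<lparr>carrier := A\<rparr> Mod K\<close>.\<close>

definition quotient_structure ::
    "('a, 'r, 'c) induced_structure \<Rightarrow> ('c, 'm) monoid_scheme \<Rightarrow> 'c set \<Rightarrow> 'c set
      \<Rightarrow> ('a, 'r, 'c set) induced_structure" where
  "quotient_structure S G A K =
     \<lparr>base = base S, ext = ext S,
      pres = (\<lambda>x. case pres S x of
                    Some g \<Rightarrow> if g \<in> A then Some (K #>\<^bsub>G\<^esub> g) else None
                  | None \<Rightarrow> None)\<rparr>"

definition def_subgroup ::
    "('a, 'r, 'c) induced_structure \<Rightarrow> ('c, 'm) monoid_scheme \<Rightarrow> 'c set \<Rightarrow> bool" where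
  "def_subgroup S G A \<longleftrightarrow> subgroup A G \<and> def_set S A"

definition connected_subgroup ::
    "('a, 'r, 'c) induced_structure \<Rightarrow> ('c, 'm) monoid_scheme \<Rightarrow> 'c set \<Rightarrow> bool" where
  "connected_subgroup S G A \<longleftrightarrow>
     \<not> (\<exists>B. def_subgroup S G B \<and> B \<subset> A \<and> finite (rcosets\<^bsub>G\<lparr>carrier := A\<rparr>\<^esub> B))"

definition indecomposable ::
    "('a, 'r, 'c) induced_structure \<Rightarrow> ('c, 'm) monoid_scheme \<Rightarrow> 'c set \<Rightarrow> bool" where
  "indecomposable S G A \<longleftrightarrow>
     \<not> (\<exists>A1 A2. def_subgroup S G A1 \<and> def_subgroup S G A2 \<and> A1 \<subset> A \<and> A2 \<subset> A \<and>
               A1 <#>\<^bsub>G\<^esub> A2 = A)"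

definition definable_supplement ::
    "('a, 'r, 'c) induced_structure \<Rightarrow> ('c, 'm) monoid_scheme \<Rightarrow> 'c set \<Rightarrow> 'c set \<Rightarrow> 'c set
      \<Rightarrow> bool" where
  "definable_supplement S G A B C \<longleftrightarrow> def_subgroup S G C \<and> C \<subset> A \<and> B <#>\<^bsub>G\<^esub> C = A"

definition radical_candidate ::
    "('a, 'r, 'c) induced_structure \<Rightarrow> ('c, 'm) monoid_scheme \<Rightarrow> 'c set \<Rightarrow> 'c set \<Rightarrow> bool" where
  "radical_candidate S G A B \<longleftrightarrow>
     def_subgroup S G B \<and> B \<subset> A \<and> connected_subgroup S G B \<and>
     \<not> (\<exists>C. definable_supplement S G A B C)"

definition radical ::
    "('a, 'r, 'c) induced_structure \<Rightarrow> ('c, 'm) monoid_scheme \<Rightarrow> 'c set \<Rightarrow> 'c set" where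
  "radical S G A =
     (THE J. radical_candidate S G A J \<and> (\<forall>B. radical_candidate S G A B \<and> J \<subseteq> B \<longrightarrow> B = J))"

definition reduced_rank ::
    "('a, 'r, 'c) induced_structure \<Rightarrow> ('c, 'm) monoid_scheme \<Rightarrow> 'c set \<Rightarrow> nat" where
  "reduced_rank S G A = morley_rank (quotient_structure S G A (radical S G A))"

definition torsion_free :: "('c, 'm) monoid_scheme \<Rightarrow> bool" where
  "torsion_free Q \<longleftrightarrow>
     (\<forall>x\<in>carrier Q. \<forall>n::nat. n > 0 \<and> x [^]\<^bsub>Q\<^esub> n = \<one>\<^bsub>Q\<^esub> \<longrightarrow> x = \<one>\<^bsub>Q\<^esub>)"

text \<open>The trivial group is excluded among the generators because the radical and the reduced
  rank are defined for nontrivial groups only.\<close>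

definition U0 ::
    "('a, 'r, 'c) induced_structure \<Rightarrow> int \<Rightarrow> ('c, 'm) monoid_scheme \<Rightarrow> 'c set" where
  "U0 S r G = generate G (\<Union>{A. def_subgroup S G A \<and> comm_group (G\<lparr>carrier := A\<rparr>) \<and>
       A \<noteq> {\<one>\<^bsub>G\<^esub>} \<and> indecomposable S G A \<and> int (reduced_rank S G A) = r \<and>
       torsion_free (G\<lparr>carrier := A\<rparr> Mod radical S G A)})"

definition U0_group ::
    "('a, 'r, 'c) induced_structure \<Rightarrow> int \<Rightarrow> ('c, 'm) monoid_scheme \<Rightarrow> bool" where
  "U0_group S r G \<longleftrightarrow> fmr_group S G \<and> U0 S r G = carrier G"


section \<open>Nilpotent groups\<close>

primrec lower_central :: "('c, 'm) monoid_scheme \<Rightarrow> nat \<Rightarrow> 'c set" where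
  "lower_central G 0 = carrier G"
| "lower_central G (Suc n) =
     generate G {x \<otimes>\<^bsub>G\<^esub> y \<otimes>\<^bsub>G\<^esub> inv\<^bsub>G\<^esub> x \<otimes>\<^bsub>G\<^esub> inv\<^bsub>G\<^esub> y | x y.
                   x \<in> lower_central G n \<and> y \<in> carrier G}"

definition nilpotent :: "('c, 'm) monoid_scheme \<Rightarrow> bool" where
  "nilpotent G \<longleftrightarrow> (\<exists>n. lower_central G n = {\<one>\<^bsub>G\<^esub>})"

end

theory Submission
  imports Defs "HOL-Algebra.Zassenhaus"
begin

text \<open>Let \<open>k\<close> be the last index for which the term \<open>L\<^sub>k\<close> of the lower central series is not
  contained in \<open>H\<close>; it exists because \<open>G\<close> is nilpotent and \<open>H\<close> is proper.  Then
  \<open>[L\<^sub>k, H] \<le> L\<^bsub>k+1\<^esub> \<le> H\<close>, so \<open>L\<^sub>k\<close> normalizes \<open>H\<close>.  For fixed \<open>y\<^sub>1, \<dots>, y\<^sub>k\<close> the map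
  \<open>x \<mapsto> [x, y\<^sub>1, \<dots>, y\<^sub>k]\<close> is a homomorphism modulo \<open>L\<^bsub>k+1\<^esub>\<close>, hence a definable homomorphism from
  \<open>G\<close> to \<open>N(H)/H\<close>.  As \<open>G\<close> is generated by the indecomposable subgroups \<open>A\<close> in the definition of
  \<open>U\<^bsub>0,r\<^esub>\<close>, and \<open>L\<^sub>k\<close> is not contained in \<open>H\<close>, one of these maps is nontrivial on one such \<open>A\<close>
  (\<open>ex_iterated_commutator_outside\<close>).  This avoids any question about the definability of the
  lower central series.

  It remains to see that the image of a generator \<open>A\<close> under a nontrivial definable homomorphism \<open>f\<close>
  is again a generator, with the same \<open>r\<close> (\<open>U0_generator_image\<close>).  The point is that the radical
  \<open>J(A)\<close> contains every proper definable subgroup \<open>K\<close> of \<open>A\<close>, connected or not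
  (\<open>proper_def_subgroup_le_radical\<close>): the connected part of \<open>K\<close> lies in \<open>J(A)\<close> since \<open>A\<close> is
  indecomposable, and the rest of \<open>K\<close> is torsion over it while \<open>A/J(A)\<close> is torsion-free.  So the
  kernel of \<open>f\<close> is inside \<open>J(A)\<close>, the proper definable subgroups of \<open>f(A)\<close> are those inside
  \<open>f(J(A))\<close>, and \<open>J(f(A)) = f(J(A))\<close>.  Thus \<open>f\<close> induces a definable isomorphism from \<open>A/J(A)\<close>
  to \<open>f(A)/J(f(A))\<close>, which preserves rank and absence of torsion.

  Model theory enters in three places.  The radical is a maximal connected definable subgroup and
  the connected part of \<open>K\<close> a minimal definable one; both exist because a coset of a larger group
  is a disjoint union of cosets of a smaller one, so long chains force large rank
  (\<open>levels_bounded\<close>).  Invariance of rank under definable bijections holds because being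
  a bijection is a first-order property, which passes to the saturated extension
  (\<open>rank_ge_eq_of_definable_bijection\<close>).  Finally, definability of the many sets involved is
  derived by closure rules for uniformly definable predicates, first for elements of the
  structure and then for elements of the presented group.\<close>

section \<open>Substitution of variables in formulas\<close>

primrec vars :: "'r fm \<Rightarrow> nat set" where
  "vars (Rel R ns) = set ns"
| "vars (Eq i j) = {i, j}"
| "vars (Neg \<phi>) = vars \<phi>"
| "vars (Conj \<phi> \<psi>) = vars \<phi> \<union> vars \<psi>"
| "vars (Ex i \<phi>) = insert i (vars \<phi>)"

lemma finite_vars: "finite (vars \<phi>)"
  by (induction \<phi>) auto

lemma sat_cong: "(\<And>i. i \<in> vars \<phi> \<Longrightarrow> v i = w i) \<Longrightarrow> sat M \<phi> v \<longleftrightarrow> sat M \<phi> w"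
proof (induction \<phi> arbitrary: v w)
  case (Rel R ns)
  then have "map v ns = map w ns" by (intro map_cong) auto
  then show ?case by (simp only: sat.simps)
next
  case (Ex i \<phi>)
  have "sat M \<phi> (v(i := a)) \<longleftrightarrow> sat M \<phi> (w(i := a))" for a
    by (rule Ex.IH) (use Ex.prems in auto)
  then show ?case by simp
next
  case (Conj \<phi> \<psi>)
  have "sat M \<phi> v \<longleftrightarrow> sat M \<phi> w" by (rule Conj.IH) (use Conj.prems in auto)
  moreover have "sat M \<psi> v \<longleftrightarrow> sat M \<psi> w" by (rule Conj.IH) (use Conj.prems in auto)
  ultimately show ?case by simp
next
  case (Neg \<phi>)
  have "sat M \<phi> v \<longleftrightarrow> sat M \<phi> w" by (rule Neg.IH) (use Neg.prems in auto)
  then show ?case by simp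
qed auto

text \<open>A bound variable is renamed to one larger than every variable that the substitution
  puts into its scope, so that nothing is captured.\<close>

primrec substitute :: "(nat \<Rightarrow> nat) \<Rightarrow> 'r fm \<Rightarrow> 'r fm" where
  "substitute f (Rel R ns) = Rel R (map f ns)"
| "substitute f (Eq i j) = Eq (f i) (f j)"
| "substitute f (Neg \<phi>) = Neg (substitute f \<phi>)"
| "substitute f (Conj \<phi> \<psi>) = Conj (substitute f \<phi>) (substitute f \<psi>)"
| "substitute f (Ex i \<phi>) =
     (let n = Suc (Max (insert 0 (f ` vars \<phi>))) in Ex n (substitute (f(i := n)) \<phi>))"

lemma sat_substitute: "sat M (substitute f \<phi>) v \<longleftrightarrow> sat M \<phi> (v \<circ> f)"
proof (induction \<phi> arbitrary: f v)
  case (Ex i \<phi>)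
  define n where "n = Suc (Max (insert 0 (f ` vars \<phi>)))"
  have "f j < n" if "j \<in> vars \<phi>" for j
    unfolding n_def less_Suc_eq_le by (rule Max_ge) (use that finite_vars in auto)
  then have *: "sat M \<phi> (v(n := a) \<circ> f(i := n)) \<longleftrightarrow> sat M \<phi> ((v \<circ> f)(i := a))" for a
    by (intro sat_cong) fastforce
  show ?case unfolding substitute.simps Let_def n_def[symmetric] sat.simps Ex.IH * ..
qed (simp_all add: comp_def)

section \<open>Predicates that are uniformly definable in a structure and an extension\<close>

primrec exs :: "nat \<Rightarrow> 'r fm \<Rightarrow> 'r fm" where
  "exs 0 \<phi> = \<phi>"
| "exs (Suc k) \<phi> = Ex k (exs k \<phi>)"

lemma sat_exs:
  "sat M (exs k \<phi>) v \<longleftrightarrow>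
     (\<exists>xs. length xs = k \<and> set xs \<subseteq> universe M \<and> sat M \<phi> (\<lambda>i. if i < k then xs ! i else v i))"
proof (induction k arbitrary: v)
  case (Suc k)
  have eq: "(\<lambda>i. if i < k then xs ! i else (v(k := a)) i) =
      (\<lambda>i. if i < Suc k then (xs @ [a]) ! i else v i)" if "length xs = k" for xs a
    using that by (auto simp: fun_eq_iff nth_append less_Suc_eq)
  have "sat M (exs (Suc k) \<phi>) v \<longleftrightarrow> (\<exists>a\<in>universe M. \<exists>xs. length xs = k \<and> set xs \<subseteq> universe M \<and>
      sat M \<phi> (\<lambda>i. if i < Suc k then (xs @ [a]) ! i else v i))"
    using eq by (simp add: Suc.IH cong: conj_cong)
  also have "\<dots> \<longleftrightarrow> (\<exists>ys. length ys = Suc k \<and> set ys \<subseteq> universe M \<and>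
      sat M \<phi> (\<lambda>i. if i < Suc k then ys ! i else v i))"
  proof (intro iffI; elim exE conjE bexE)
    fix a xs
    assume "a \<in> universe M" "length xs = k" "set xs \<subseteq> universe M"
      "sat M \<phi> (\<lambda>i. if i < Suc k then (xs @ [a]) ! i else v i)"
    then show "\<exists>ys. length ys = Suc k \<and> set ys \<subseteq> universe M \<and>
      sat M \<phi> (\<lambda>i. if i < Suc k then ys ! i else v i)"
      by (intro exI[of _ "xs @ [a]"]) auto
  next
    fix ys :: "'a list"
    assume ys: "length ys = Suc k" "set ys \<subseteq> universe M"
      "sat M \<phi> (\<lambda>i. if i < Suc k then ys ! i else v i)"
    then obtain xs a where xs: "ys = xs @ [a]" by (cases ys rule: rev_cases) auto
    then show "\<exists>a\<in>universe M. \<exists>xs. length xs = k \<and> set xs \<subseteq> universe M \<and>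
      sat M \<phi> (\<lambda>i. if i < Suc k then (xs @ [a]) ! i else v i)"
      using ys by (intro bexI[of _ a] exI[of _ xs]) auto
  qed
  finally show ?case .
qed simp

text \<open>Two formulas with different parameters are compared by a single sentence once the
  parameters of the first are moved to the even and those of the second to the odd places,
  counted from \<open>k\<close>.\<close>

lemma defined_set_eq_transfer:
  assumes ext: "elementary_extension M N"
    and v: "range v \<subseteq> universe M" and w: "range w \<subseteq> universe M"
    and eq: "defined_set M k \<phi> v = defined_set M k \<psi> w"
  shows "defined_set N k \<phi> v = defined_set N k \<psi> w"
proof -
  define f where "f i = (if i < k then i else k + 2 * (i - k))" for i
  define g where "g i = (if i < k then i else k + 2 * (i - k) + 1)" for i
  define u where "u i = (if i < k then v i
    else if even (i - k) then v (k + (i - k) div 2) else w (k + (i - k) div 2))" for i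
  define \<chi> where "\<chi> = exs k (Neg (Conj (Neg (Conj (substitute f \<phi>) (Neg (substitute g \<psi>))))
                                 (Neg (Conj (Neg (substitute f \<phi>)) (substitute g \<psi>)))))"
  have u: "range u \<subseteq> universe M" using v w by (auto simp: u_def)
  have uf: "(\<lambda>i. if i < k then xs ! i else u i) \<circ> f = (\<lambda>i. if i < k then xs ! i else v i)"
    and ug: "(\<lambda>i. if i < k then xs ! i else u i) \<circ> g = (\<lambda>i. if i < k then xs ! i else w i)"
    for xs :: "'a list"
    by (auto simp: fun_eq_iff f_def g_def u_def)
  have *: "sat L \<chi> u \<longleftrightarrow> defined_set L k \<phi> v \<noteq> defined_set L k \<psi> w" for L :: "('a, 'b) fo_structure"
    unfolding \<chi>_def sat_exs defined_set_def set_eq_iff by (auto simp: sat_substitute uf ug)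
  show ?thesis using ext u *[of M] *[of N] eq by (auto simp: elementary_extension_def)
qed

text \<open>By the preceding lemma the definite description in \<open>realization\<close> has a unique solution.\<close>

lemma realization_defined_set:
  assumes "elementary_extension M N" "range v \<subseteq> universe M"
  shows "realization M N k (defined_set M k \<phi> v) = defined_set N k \<phi> v"
  unfolding realization_def
proof (rule the_equality)
  show "\<exists>\<psi> w. range w \<subseteq> universe M \<and> defined_set M k \<phi> v = defined_set M k \<psi> w \<and>
      defined_set N k \<phi> v = defined_set N k \<psi> w"
    using assms by blast
next
  fix T'
  assume "\<exists>\<psi> w. range w \<subseteq> universe M \<and> defined_set M k \<phi> v = defined_set M k \<psi> w \<and>
      T' = defined_set N k \<psi> w"
  then show "T' = defined_set N k \<phi> v" using defined_set_eq_transfer assms by metis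
qed

lemma elementary_extension_refl: "universe M \<noteq> {} \<Longrightarrow> elementary_extension M M"
  by (simp add: elementary_extension_def)

lemma definable_realization:
  assumes "elementary_extension M N" "definable M k T"
  shows "definable N k (realization M N k T)"
  using assms realization_defined_set[OF assms(1)]
  unfolding definable_def elementary_extension_def by (metis order_trans)

text \<open>The two structures are handled at once: index \<open>True\<close> stands for the base structure and
  \<open>False\<close> for its extension.  In \<open>mix e v\<close> the even places hold the free variables and the
  odd ones the parameters, which leaves infinitely many of both.\<close>

abbreviation (input) structure_at where
  "structure_at M N b \<equiv> (if b then M else N)"

abbreviation (input) realization_at where
  "realization_at M N k T b \<equiv> (if b then T else realization M N k T)"

definition mix :: "(nat \<Rightarrow> 'a) \<Rightarrow> (nat \<Rightarrow> 'a) \<Rightarrow> nat \<Rightarrow> 'a" where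
  "mix e v i = (if even i then e (i div 2) else v (i div 2))"

definition uniformly_definable ::
    "('a, 'r) fo_structure \<Rightarrow> ('a, 'r) fo_structure \<Rightarrow> (bool \<Rightarrow> (nat \<Rightarrow> 'a) \<Rightarrow> bool) \<Rightarrow> bool" where
  "uniformly_definable M N P \<longleftrightarrow> (\<exists>\<phi> v. range v \<subseteq> universe M \<and>
     (\<forall>b e. range e \<subseteq> universe (structure_at M N b) \<longrightarrow>
        (P b e \<longleftrightarrow> sat (structure_at M N b) \<phi> (mix e v))))"

lemma uniformly_definableE:
  assumes "uniformly_definable M N P"
  obtains \<phi> v where "range v \<subseteq> universe M"
    "\<And>b e. range e \<subseteq> universe (structure_at M N b) \<Longrightarrow>
        P b e \<longleftrightarrow> sat (structure_at M N b) \<phi> (mix e v)"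
proof -
  obtain \<phi> v where v: "range v \<subseteq> universe M"
    and *: "\<forall>b e. range e \<subseteq> universe (structure_at M N b) \<longrightarrow>
        (P b e \<longleftrightarrow> sat (structure_at M N b) \<phi> (mix e v))"
    using assms unfolding uniformly_definable_def by (elim exE conjE)
  show ?thesis by (rule that[of v \<phi>, OF v]) (rule *[rule_format])
qed

lemma uniformly_definableI:
  assumes "range v \<subseteq> universe M"
    "\<And>b e. range e \<subseteq> universe (structure_at M N b) \<Longrightarrow>
        P b e \<longleftrightarrow> sat (structure_at M N b) \<phi> (mix e v)"
  shows "uniformly_definable M N P"
  unfolding uniformly_definable_def using assms by (intro exI[of _ \<phi>] exI[of _ v] conjI allI impI)

lemma uniformly_definable_neg:
  assumes "uniformly_definable M N P"
  shows "uniformly_definable M N (\<lambda>b e. \<not> P b e)"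
proof -
  obtain \<phi> v where v: "range v \<subseteq> universe M" "\<And>b e. range e \<subseteq> universe (structure_at M N b) \<Longrightarrow>
        P b e \<longleftrightarrow> sat (structure_at M N b) \<phi> (mix e v)"
    by (rule uniformly_definableE[OF assms]) (rule that, assumption, simp)
  then show ?thesis by (intro uniformly_definableI[where \<phi> = "Neg \<phi>" and v = v]) simp_all
qed

lemma uniformly_definable_conj:
  assumes "uniformly_definable M N P" "uniformly_definable M N Q"
  shows "uniformly_definable M N (\<lambda>b e. P b e \<and> Q b e)"
proof -
  obtain \<phi> v where v: "range v \<subseteq> universe M" "\<And>b e. range e \<subseteq> universe (structure_at M N b) \<Longrightarrow>
        (P b e \<longleftrightarrow> sat (structure_at M N b) \<phi> (mix e v))"
    by (rule uniformly_definableE[OF assms(1)]) (rule that, assumption, simp)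
  obtain \<psi> w where w: "range w \<subseteq> universe M" "\<And>b e. range e \<subseteq> universe (structure_at M N b) \<Longrightarrow>
        (Q b e \<longleftrightarrow> sat (structure_at M N b) \<psi> (mix e w))"
    by (rule uniformly_definableE[OF assms(2)]) (rule that, assumption, simp)
  define f :: "nat \<Rightarrow> nat" where "f i = (if even i then i else 2 * (2 * (i div 2)) + 1)" for i
  define g :: "nat \<Rightarrow> nat" where "g i = (if even i then i else 2 * (2 * (i div 2) + 1) + 1)" for i
  have "mix e (mix v w) \<circ> f = mix e v" "mix e (mix v w) \<circ> g = mix e w" for e
    by (auto simp: fun_eq_iff mix_def f_def g_def elim!: oddE)
  moreover have "range (mix v w) \<subseteq> universe M" using v(1) w(1) by (auto simp: mix_def)
  ultimately show ?thesis
    by (intro uniformly_definableI[where \<phi> = "Conj (substitute f \<phi>) (substitute g \<psi>)" and v = "mix v w"])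
      (simp_all add: sat_substitute v(2) w(2))
qed

lemma uniformly_definable_reindex:
  assumes "uniformly_definable M N P"
  shows "uniformly_definable M N (\<lambda>b e. P b (\<lambda>i. e (f i)))"
proof -
  obtain \<phi> v where v: "range v \<subseteq> universe M" "\<And>b e. range e \<subseteq> universe (structure_at M N b) \<Longrightarrow>
        (P b e \<longleftrightarrow> sat (structure_at M N b) \<phi> (mix e v))"
    by (rule uniformly_definableE[OF assms]) (rule that, assumption, simp)
  define g where "g i = (if even i then 2 * f (i div 2) else i)" for i
  have "mix e v \<circ> g = mix (\<lambda>i. e (f i)) v" for e
    by (auto simp: fun_eq_iff mix_def g_def)
  moreover have "P b (\<lambda>i. e (f i)) \<longleftrightarrow> sat (structure_at M N b) \<phi> (mix (\<lambda>i. e (f i)) v)"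
    if "range e \<subseteq> universe (structure_at M N b)" for b e
    by (rule v(2)) (use that in blast)
  ultimately show ?thesis
    by (intro uniformly_definableI[where \<phi> = "substitute g \<phi>" and v = v]) (simp_all add: sat_substitute v(1))
qed

text \<open>The premise has the form \<open>Q b (\<lambda>i. e (Suc i)) (e 0)\<close> so that higher-order unification can
  strip a quantifier from a predicate, the bound variable becoming entry \<open>0\<close> of the valuation.

  In the formula the quantified variable becomes the odd place \<open>1\<close>; the parameters are shifted by one to
  keep it free.\<close>

lemma uniformly_definable_ex:
  assumes "uniformly_definable M N (\<lambda>b e. Q b (\<lambda>i. e (Suc i)) (e 0))"
  shows "uniformly_definable M N (\<lambda>b e. \<exists>x\<in>universe (structure_at M N b). Q b e x)"
proof -
  obtain \<phi> v where v: "range v \<subseteq> universe M" "\<And>b e. range e \<subseteq> universe (structure_at M N b) \<Longrightarrow>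
        (Q b (\<lambda>i. e (Suc i)) (e 0) \<longleftrightarrow> sat (structure_at M N b) \<phi> (mix e v))"
    by (rule uniformly_definableE[OF assms]) (rule that, assumption, simp)
  define f :: "nat \<Rightarrow> nat" where "f i = (if i = 0 then 1 else if even i then i - 2 else i + 2)" for i
  define w where "w i = v (i - 1)" for i
  have eq: "(mix e w)(1 := x) \<circ> f = mix (case_nat x e) v" for e x
    by (auto simp: fun_eq_iff mix_def f_def w_def split: nat.split elim!: evenE oddE)
  have "Q b e x \<longleftrightarrow> sat (structure_at M N b) \<phi> (mix (case_nat x e) v)"
    if "range e \<subseteq> universe (structure_at M N b)" "x \<in> universe (structure_at M N b)" for b e x
    using v(2)[of "case_nat x e" b] that by (fastforce split: nat.splits)
  then show ?thesis
    by (intro uniformly_definableI[where \<phi> = "Ex 1 (substitute f \<phi>)" and v = w])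
      (use v(1) in \<open>auto simp: sat_substitute eq[simplified] w_def simp del: fun_upd_apply\<close>)
qed

lemma uniformly_definable_eq_const:
  "c \<in> universe M \<Longrightarrow> uniformly_definable M N (\<lambda>b e. e i = c)"
  by (intro uniformly_definableI[where \<phi> = "Eq (2 * i) 1" and v = "\<lambda>_. c"]) (auto simp: mix_def)

lemma uniformly_definable_in:
  assumes ext: "elementary_extension M N" and T: "definable M (length ns) T"
  shows "uniformly_definable M N (\<lambda>b e. map e ns \<in> realization_at M N (length ns) T b)"
proof -
  obtain \<phi> v where v: "range v \<subseteq> universe M" "T = defined_set M (length ns) \<phi> v"
    using T unfolding definable_def by blast
  define f where "f i = (if i < length ns then 2 * (ns ! i) else 2 * i + 1)" for i
  have eq: "mix e v \<circ> f = (\<lambda>i. if i < length ns then map e ns ! i else v i)" for e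
    by (auto simp: fun_eq_iff mix_def f_def)
  have "map e ns \<in> realization_at M N (length ns) T b \<longleftrightarrow>
      sat (structure_at M N b) \<phi> (mix e v \<circ> f)"
    if "range e \<subseteq> universe (structure_at M N b)" for b e
    unfolding v(2) realization_defined_set[OF ext v(1)] eq using that
    by (auto simp: defined_set_def split: if_splits)
  then show ?thesis
    by (intro uniformly_definableI[where \<phi> = "substitute f \<phi>" and v = v]) (simp_all add: v(1) sat_substitute)
qed

lemma uniformly_definable_in1:
  assumes "elementary_extension M N" "definable M 1 T"
  shows "uniformly_definable M N (\<lambda>b e. [e i] \<in> realization_at M N 1 T b)"
proof -
  have "length [i] = 1" by simp
  then show ?thesis using uniformly_definable_in[OF assms(1), of "[i]" T] assms(2)
    by (simp only: list.map)
qed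

lemma uniformly_definable_in2:
  assumes "elementary_extension M N" "definable M 2 T"
  shows "uniformly_definable M N (\<lambda>b e. [e i, e j] \<in> realization_at M N 2 T b)"
proof -
  have "length [i, j] = 2" by simp
  then show ?thesis using uniformly_definable_in[OF assms(1), of "[i, j]" T] assms(2)
    by (simp only: list.map)
qed

lemma uniformly_definable_disj:
  assumes "uniformly_definable M N P" "uniformly_definable M N Q"
  shows "uniformly_definable M N (\<lambda>b e. P b e \<or> Q b e)"
proof -
  have "uniformly_definable M N (\<lambda>b e. \<not> (\<not> P b e \<and> \<not> Q b e))"
    using assms by (intro uniformly_definable_neg uniformly_definable_conj)
  then show ?thesis by simp
qed

lemma uniformly_definable_imp:
  assumes "uniformly_definable M N P" "uniformly_definable M N Q"
  shows "uniformly_definable M N (\<lambda>b e. P b e \<longrightarrow> Q b e)"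
proof -
  have "uniformly_definable M N (\<lambda>b e. \<not> P b e \<or> Q b e)"
    using assms by (intro uniformly_definable_neg uniformly_definable_disj)
  then show ?thesis by (simp only: imp_conv_disj)
qed

lemma uniformly_definable_all:
  assumes "uniformly_definable M N (\<lambda>b e. Q b (\<lambda>i. e (Suc i)) (e 0))"
  shows "uniformly_definable M N (\<lambda>b e. \<forall>x\<in>universe (structure_at M N b). Q b e x)"
proof -
  have "uniformly_definable M N (\<lambda>b e. \<not> (\<exists>x\<in>universe (structure_at M N b). \<not> Q b e x))"
    using assms by (intro uniformly_definable_neg uniformly_definable_ex)
  then show ?thesis by simp
qed

lemmas uniformly_definable_intros =
  uniformly_definable_neg uniformly_definable_conj uniformly_definable_disj
  uniformly_definable_imp uniformly_definable_ex uniformly_definable_all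
  uniformly_definable_in1 uniformly_definable_in2

text \<open>A predicate that ignores its valuation is given by a sentence with parameters in the base
  structure.\<close>

lemma uniformly_definable_transfer:
  assumes "elementary_extension M N" "uniformly_definable M N (\<lambda>b _. P b)"
  shows "P True \<longleftrightarrow> P False"
proof -
  obtain \<phi> v where v: "range v \<subseteq> universe M" and *: "\<And>b e. range e \<subseteq> universe (structure_at M N b) \<Longrightarrow>
        (P b \<longleftrightarrow> sat (structure_at M N b) \<phi> (mix e v))"
    by (rule uniformly_definableE[OF assms(2)]) (rule that, assumption, simp)
  have "range (mix v v) \<subseteq> universe M" using v by (auto simp: mix_def)
  then have "sat M \<phi> (mix v v) \<longleftrightarrow> sat N \<phi> (mix v v)" and "range v \<subseteq> universe N"
    using assms(1) v unfolding elementary_extension_def by blast+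
  then show ?thesis using *[of v True] *[of v False] v by simp
qed

lemma definable_of_uniformly_definable:
  assumes "uniformly_definable M M (\<lambda>_. P)"
    and cong: "\<And>e e'. (\<And>i. i < k \<Longrightarrow> e i = e' i) \<Longrightarrow> P e \<longleftrightarrow> P e'"
  shows "definable M k {xs. length xs = k \<and> set xs \<subseteq> universe M \<and> P (\<lambda>i. xs ! i)}"
proof -
  obtain \<phi> v where v: "range v \<subseteq> universe M" "\<And>e. range e \<subseteq> universe M \<Longrightarrow>
        (P e \<longleftrightarrow> sat M \<phi> (mix e v))"
    using assms(1) by (rule uniformly_definableE) (metis (full_types))
  \<comment> \<open>Free variables from \<open>k\<close> on do not matter; all of them are sent to the place \<open>k\<close>, which holds
    the parameter \<open>v 0\<close> and so always has a value in the universe.\<close>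
  define f where "f i = (if even i then if i div 2 < k then i div 2 else k else k + i div 2)" for i
  define w where "w i = v (i - k)" for i
  define env where "env xs i = (if i < k then xs ! i else v 0)" for xs :: "'a list" and i
  have "(\<lambda>i. if i < k then xs ! i else w i) \<circ> f = mix (env xs) v" for xs
    by (auto simp: fun_eq_iff mix_def f_def w_def env_def)
  moreover have "P (\<lambda>i. xs ! i) \<longleftrightarrow> sat M \<phi> (mix (env xs) v)"
    if "length xs = k" "set xs \<subseteq> universe M" for xs
  proof -
    have "range (env xs) \<subseteq> universe M" using that v(1) by (auto simp: env_def)
    moreover have "P (\<lambda>i. xs ! i) \<longleftrightarrow> P (env xs)" by (rule cong) (simp add: env_def)
    ultimately show ?thesis using v(2) by simp
  qed
  ultimately have "{xs. length xs = k \<and> set xs \<subseteq> universe M \<and> P (\<lambda>i. xs ! i)} =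
      defined_set M k (substitute f \<phi>) w"
    by (auto simp: defined_set_def sat_substitute)
  moreover have "range w \<subseteq> universe M" using v(1) by (auto simp: w_def)
  ultimately show ?thesis unfolding definable_def by blast
qed

lemma definable1_of_uniformly_definable:
  assumes "uniformly_definable M M (\<lambda>_ e. P (e 0))"
  shows "definable M 1 {[x] | x. x \<in> universe M \<and> P x}"
proof -
  have "definable M 1 {xs. length xs = 1 \<and> set xs \<subseteq> universe M \<and> P (xs ! 0)}"
    by (rule definable_of_uniformly_definable[where P = "\<lambda>e. P (e 0)"]) (use assms in simp_all)
  moreover have "{xs. length xs = 1 \<and> set xs \<subseteq> universe M \<and> P (xs ! 0)} =
      {[x] | x. x \<in> universe M \<and> P x}"
    by (auto simp: length_Suc_conv)
  ultimately show ?thesis by simp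
qed

lemma definable2_of_uniformly_definable:
  assumes "uniformly_definable M M (\<lambda>_ e. P (e 0) (e 1))"
  shows "definable M 2 {[x, y] | x y. x \<in> universe M \<and> y \<in> universe M \<and> P x y}"
proof -
  have "definable M 2 {xs. length xs = 2 \<and> set xs \<subseteq> universe M \<and> P (xs ! 0) (xs ! 1)}"
    by (rule definable_of_uniformly_definable[where P = "\<lambda>e. P (e 0) (e 1)"]) (use assms in simp_all)
  moreover have "{xs. length xs = 2 \<and> set xs \<subseteq> universe M \<and> P (xs ! 0) (xs ! 1)} =
      {[x, y] | x y. x \<in> universe M \<and> y \<in> universe M \<and> P x y}"
    by (auto simp: length_Suc_conv numeral_2_eq_2)
  ultimately show ?thesis by simp
qed

section \<open>Definability in a group of finite Morley rank\<close>

abbreviation definable_predicate ::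
    "('a, 'r) fo_structure \<Rightarrow> ((nat \<Rightarrow> 'a) \<Rightarrow> bool) \<Rightarrow> bool" where
  "definable_predicate M Q \<equiv> uniformly_definable M M (\<lambda>_. Q)"

lemma definable_predicate_ex:
  assumes "definable_predicate M Q"
  shows "definable_predicate M (\<lambda>e. \<exists>x\<in>universe M. Q (case_nat x e))"
proof -
  have "case_nat (e 0) (\<lambda>i. e (Suc i)) = e" for e :: "nat \<Rightarrow> 'a"
    by (auto simp: fun_eq_iff split: nat.splits)
  then show ?thesis
    using uniformly_definable_ex[of M M "\<lambda>_ e x. Q (case_nat x e)"] assms by simp
qed

lemma definable_predicate_in:
  assumes "universe M \<noteq> {}" "definable M (length ns) T"
  shows "definable_predicate M (\<lambda>e. map e ns \<in> T)"
proof -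
  obtain \<phi> v where v: "range v \<subseteq> universe M" "T = defined_set M (length ns) \<phi> v"
    using assms unfolding definable_def by blast
  note ext = elementary_extension_refl[OF assms(1)]
  have "realization M M (length ns) T = T"
    unfolding v(2) using realization_defined_set[OF ext v(1)] by simp
  with uniformly_definable_in[OF ext assms(2)] show ?thesis by (simp only: if_cancel)
qed

lemma definable_predicate_in1:
  "universe M \<noteq> {} \<Longrightarrow> definable M 1 T \<Longrightarrow> definable_predicate M (\<lambda>e. [e i] \<in> T)"
  and definable_predicate_in2:
  "universe M \<noteq> {} \<Longrightarrow> definable M 2 T \<Longrightarrow> definable_predicate M (\<lambda>e. [e i, e j] \<in> T)"
  and definable_predicate_in3:
  "universe M \<noteq> {} \<Longrightarrow> definable M 3 T \<Longrightarrow> definable_predicate M (\<lambda>e. [e i, e j, e k] \<in> T)"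
  using definable_predicate_in[of M "[i]" T] definable_predicate_in[of M "[i, j]" T]
    definable_predicate_in[of M "[i, j, k]" T] by (simp_all add: numeral_2_eq_2 numeral_3_eq_3)

locale fmr =
  fixes S :: "('a, 'r, 'c) induced_structure"
    and G :: "('c, 'm) monoid_scheme" (structure)
  assumes fmr: "fmr_group S G"
begin

sublocale group G
  using fmr by (simp add: fmr_group_def)

lemma elementary: "elementary_extension (base S) (ext S)"
  and dom_pres: "dom (pres S) \<subseteq> universe (base S)"
  and ran_pres: "ran (pres S) = carrier G"
  and definable_dom: "definable (base S) 1 {[x] | x. x \<in> dom (pres S)}"
  and definable_kernel: "definable (base S) 2 (pres_kernel S)"
  and definable_mult: "definable (base S) 3
       {[x, y, z] | x y z. \<exists>a b. pres S x = Some a \<and> pres S y = Some b \<and>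
                              pres S z = Some (a \<otimes> b)}"
  using fmr by (simp_all add: fmr_group_def)

lemma universe_nonempty: "universe (base S) \<noteq> {}"
  using elementary by (simp add: elementary_extension_def)

lemma pres_closed: "pres S x = Some g \<Longrightarrow> g \<in> carrier G"
  using ran_pres by (auto simp: ran_def)

lemma pres_surj: assumes "g \<in> carrier G" obtains x where "pres S x = Some g"
  using assms ran_pres by (auto simp: ran_def)

lemma ex_dom_pres_iff: "(\<exists>x\<in>dom (pres S). R (the (pres S x))) \<longleftrightarrow> (\<exists>g\<in>carrier G. R g)"
  unfolding ran_pres[symmetric] by (force simp: ran_def dom_def)

text \<open>Predicates of group elements are pulled back along the presentation.  Only the values
  at arguments that present group elements matter.\<close>

definition group_definable :: "((nat \<Rightarrow> 'c) \<Rightarrow> bool) \<Rightarrow> bool" where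
  "group_definable P \<longleftrightarrow> (\<exists>Q. definable_predicate (base S) Q \<and>
     (\<forall>e. range e \<subseteq> dom (pres S) \<longrightarrow> (Q e \<longleftrightarrow> P (\<lambda>i. the (pres S (e i))))))"

lemma group_definableI:
  assumes "definable_predicate (base S) Q"
    "\<And>e. range e \<subseteq> dom (pres S) \<Longrightarrow> Q e \<longleftrightarrow> P (\<lambda>i. the (pres S (e i)))"
  shows "group_definable P"
  using assms unfolding group_definable_def by blast

lemma group_definableE:
  assumes "group_definable P"
  obtains Q where "definable_predicate (base S) Q"
    "\<And>e. range e \<subseteq> dom (pres S) \<Longrightarrow> Q e \<longleftrightarrow> P (\<lambda>i. the (pres S (e i)))"
  using assms unfolding group_definable_def by blast

lemma group_definable_cong:
  assumes "\<And>e. range e \<subseteq> carrier G \<Longrightarrow> P e \<longleftrightarrow> P' e" "group_definable P"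
  shows "group_definable P'"
proof -
  obtain Q where Q: "definable_predicate (base S) Q"
    "\<And>e. range e \<subseteq> dom (pres S) \<Longrightarrow> Q e \<longleftrightarrow> P (\<lambda>i. the (pres S (e i)))"
    by (rule group_definableE[OF assms(2)]) (rule that, assumption, simp)
  show ?thesis
  proof (rule group_definableI[OF Q(1)])
    fix e :: "nat \<Rightarrow> 'a" assume e: "range e \<subseteq> dom (pres S)"
    then have "range (\<lambda>i. the (pres S (e i))) \<subseteq> carrier G" using pres_closed by fastforce
    then show "Q e \<longleftrightarrow> P' (\<lambda>i. the (pres S (e i)))" using Q(2)[OF e] assms(1) by metis
  qed
qed

lemma group_definable_conj:
  assumes "group_definable P" "group_definable P'" shows "group_definable (\<lambda>e. P e \<and> P' e)"
proof -
  obtain Q where Q: "definable_predicate (base S) Q"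
    "\<And>e. range e \<subseteq> dom (pres S) \<Longrightarrow> Q e \<longleftrightarrow> P (\<lambda>i. the (pres S (e i)))"
    by (rule group_definableE[OF assms(1)]) (rule that, assumption, simp)
  obtain Q' where Q': "definable_predicate (base S) Q'"
    "\<And>e. range e \<subseteq> dom (pres S) \<Longrightarrow> Q' e \<longleftrightarrow> P' (\<lambda>i. the (pres S (e i)))"
    by (rule group_definableE[OF assms(2)]) (rule that, assumption, simp)
  show ?thesis
    by (rule group_definableI[OF uniformly_definable_conj[OF Q(1) Q'(1)]]) (simp add: Q(2) Q'(2))
qed

lemma group_definable_reindex:
  assumes "group_definable P" shows "group_definable (\<lambda>e. P (\<lambda>i. e (f i)))"
proof -
  obtain Q where Q: "definable_predicate (base S) Q"
    "\<And>e. range e \<subseteq> dom (pres S) \<Longrightarrow> Q e \<longleftrightarrow> P (\<lambda>i. the (pres S (e i)))"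
    by (rule group_definableE[OF assms]) (rule that, assumption, simp)
  have "Q (\<lambda>i. e (f i)) \<longleftrightarrow> P (\<lambda>i. the (pres S (e (f i))))" if "range e \<subseteq> dom (pres S)" for e
    by (rule Q(2)) (use that in blast)
  then show ?thesis
    by (intro group_definableI[OF uniformly_definable_reindex[OF Q(1), of f]])
qed

lemma group_definable_in: "def_set S X \<Longrightarrow> group_definable (\<lambda>e. e i \<in> X)"
  using definable_predicate_in[OF universe_nonempty, of "[i]" "{[x] | x. pres S x \<in> Some ` X}"]
  unfolding def_set_def by (elim conjE, intro group_definableI) (simp, fastforce)

lemma group_definable_eq_var: "group_definable (\<lambda>e. e i = e j)"
proof (rule group_definableI)
  show "definable_predicate (base S) (\<lambda>e. [e i, e j] \<in> pres_kernel S)"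
    by (rule definable_predicate_in2[OF universe_nonempty definable_kernel])
next
  fix e :: "nat \<Rightarrow> 'a" assume "range e \<subseteq> dom (pres S)"
  then have "e i \<in> dom (pres S)" "e j \<in> dom (pres S)" by auto
  then show "[e i, e j] \<in> pres_kernel S \<longleftrightarrow> the (pres S (e i)) = the (pres S (e j))"
    by (auto simp: pres_kernel_def)
qed

lemma group_definable_mult_var: "group_definable (\<lambda>e. e k = e i \<otimes> e j)"
proof (rule group_definableI)
  show "definable_predicate (base S) (\<lambda>e. [e i, e j, e k] \<in> {[x, y, z] | x y z.
      \<exists>a b. pres S x = Some a \<and> pres S y = Some b \<and> pres S z = Some (a \<otimes> b)})"
    by (rule definable_predicate_in3[OF universe_nonempty definable_mult])
next
  fix e :: "nat \<Rightarrow> 'a" assume "range e \<subseteq> dom (pres S)"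
  then have "e i \<in> dom (pres S)" "e j \<in> dom (pres S)" "e k \<in> dom (pres S)" by auto
  then show "[e i, e j, e k] \<in> {[x, y, z] | x y z.
      \<exists>a b. pres S x = Some a \<and> pres S y = Some b \<and> pres S z = Some (a \<otimes> b)} \<longleftrightarrow>
      the (pres S (e k)) = the (pres S (e i)) \<otimes> the (pres S (e j))"
    by auto
qed

lemma group_definable_eq_const:
  assumes "c \<in> carrier G" shows "group_definable (\<lambda>e. e i = c)"
proof -
  obtain a where a: "pres S a = Some c" using pres_surj assms by blast
  then have aU: "a \<in> universe (base S)" using dom_pres by auto
  show ?thesis
  proof (rule group_definableI)
    show "definable_predicate (base S)
        (\<lambda>e. \<exists>x\<in>universe (base S). case_nat x e 0 = a \<and>
           [case_nat x e (Suc i), case_nat x e 0] \<in> pres_kernel S)"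
      by (intro definable_predicate_ex[where Q = "\<lambda>e. e 0 = a \<and> [e (Suc i), e 0] \<in> pres_kernel S"]
          uniformly_definable_conj uniformly_definable_eq_const[OF aU]
          definable_predicate_in2[OF universe_nonempty definable_kernel])
  next
    fix e :: "nat \<Rightarrow> 'a" assume "range e \<subseteq> dom (pres S)"
    then have "e i \<in> dom (pres S)" by auto
    then show "(\<exists>x\<in>universe (base S). case_nat x e 0 = a \<and>
        [case_nat x e (Suc i), case_nat x e 0] \<in> pres_kernel S) \<longleftrightarrow> the (pres S (e i)) = c"
      using a aU by (auto simp: pres_kernel_def)
  qed
qed

lemma group_definable_ex:
  assumes "group_definable (\<lambda>e. P (\<lambda>i. e (Suc i)) (e 0))"
  shows "group_definable (\<lambda>e. \<exists>g\<in>carrier G. P e g)"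
proof -
  obtain Q where Q: "definable_predicate (base S) Q"
    "\<And>e. range e \<subseteq> dom (pres S) \<Longrightarrow>
       Q e \<longleftrightarrow> P (\<lambda>i. the (pres S (e (Suc i)))) (the (pres S (e 0)))"
    by (rule group_definableE[OF assms]) (rule that, assumption, simp)
  let ?D = "{[x] | x. x \<in> dom (pres S)}"
  show ?thesis
  proof (rule group_definableI)
    show "definable_predicate (base S)
        (\<lambda>e. \<exists>x\<in>universe (base S). [case_nat x e 0] \<in> ?D \<and> Q (case_nat x e))"
      by (intro definable_predicate_ex[where Q = "\<lambda>e. [e 0] \<in> ?D \<and> Q e"]
          uniformly_definable_conj Q(1) definable_predicate_in1[OF universe_nonempty definable_dom])
  next
    fix e :: "nat \<Rightarrow> 'a" assume e: "range e \<subseteq> dom (pres S)"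
    have "Q (case_nat x e) \<longleftrightarrow> P (\<lambda>i. the (pres S (e i))) (the (pres S x))"
      if "x \<in> dom (pres S)" for x
    proof -
      have "range (case_nat x e) \<subseteq> dom (pres S)" using e that by (fastforce split: nat.splits)
      then show ?thesis using Q(2)[of "case_nat x e"] by simp
    qed
    then have "(\<exists>x\<in>universe (base S). [case_nat x e 0] \<in> ?D \<and> Q (case_nat x e)) \<longleftrightarrow>
        (\<exists>x\<in>dom (pres S). P (\<lambda>i. the (pres S (e i))) (the (pres S x)))"
      using dom_pres by auto
    also have "\<dots> \<longleftrightarrow> (\<exists>g\<in>carrier G. P (\<lambda>i. the (pres S (e i))) g)"
      by (rule ex_dom_pres_iff)
    finally show "(\<exists>x\<in>universe (base S). [case_nat x e 0] \<in> ?D \<and> Q (case_nat x e)) \<longleftrightarrow>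
        (\<exists>g\<in>carrier G. P (\<lambda>i. the (pres S (e i))) g)" .
  qed
qed

text \<open>A term is definable when its graph is; the value is placed in front of the arguments.\<close>

definition definable_term :: "((nat \<Rightarrow> 'c) \<Rightarrow> 'c) \<Rightarrow> bool" where
  "definable_term t \<longleftrightarrow> (\<forall>e. range e \<subseteq> carrier G \<longrightarrow> t e \<in> carrier G) \<and>
     group_definable (\<lambda>e. e 0 = t (\<lambda>i. e (Suc i)))"

lemma definable_term_closed: "definable_term t \<Longrightarrow> range e \<subseteq> carrier G \<Longrightarrow> t e \<in> carrier G"
  by (simp add: definable_term_def)

lemma definable_term_var: "definable_term (\<lambda>e. e i)"
  using group_definable_eq_var by (auto simp: definable_term_def)

lemma definable_term_const: "c \<in> carrier G \<Longrightarrow> definable_term (\<lambda>_. c)"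
  using group_definable_eq_const by (auto simp: definable_term_def)

text \<open>Applying a definable relation to definable terms: quantify over the values.\<close>

lemma group_definable_subst:
  assumes t: "definable_term t" and P: "group_definable (\<lambda>e. P (\<lambda>i. e (Suc i)) (e 0))"
  shows "group_definable (\<lambda>e. P e (t e))"
proof -
  have "group_definable (\<lambda>e. \<exists>g\<in>carrier G. g = t e \<and> P e g)"
    using t P by (intro group_definable_ex group_definable_conj) (simp_all add: definable_term_def)
  then show ?thesis
    by (rule group_definable_cong[rotated]) (use definable_term_closed[OF t] in auto)
qed

lemma definable_term_reindex:
  assumes "definable_term t" shows "definable_term (\<lambda>e. t (\<lambda>i. e (f i)))"
proof -
  have "group_definable (\<lambda>e. e 0 = t (\<lambda>i. e (Suc (f i))))"
    using assms group_definable_reindex[of "\<lambda>e. e 0 = t (\<lambda>i. e (Suc i))" "case_nat 0 (\<lambda>i. Suc (f i))"]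
    by (simp add: definable_term_def)
  moreover have "t (\<lambda>i. e (f i)) \<in> carrier G" if "range e \<subseteq> carrier G" for e
    by (rule definable_term_closed[OF assms]) (use that in auto)
  ultimately show ?thesis by (simp add: definable_term_def)
qed

lemma group_definable_mem: "def_set S X \<Longrightarrow> definable_term t \<Longrightarrow> group_definable (\<lambda>e. t e \<in> X)"
  by (rule group_definable_subst[where P = "\<lambda>e g. g \<in> X"]) (auto intro: group_definable_in)

lemma group_definable_eq:
  assumes "definable_term s" "definable_term t" shows "group_definable (\<lambda>e. s e = t e)"
proof (rule group_definable_subst[where P = "\<lambda>e g. g = t e"])
  show "group_definable (\<lambda>e. e 0 = t (\<lambda>i. e (Suc i)))"
    using assms(2) by (simp add: definable_term_def)
qed (rule assms)

lemma definable_term_mult: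
  assumes s: "definable_term s" and t: "definable_term t"
  shows "definable_term (\<lambda>e. s e \<otimes> t e)"
proof -
  have "group_definable (\<lambda>e. e 0 = s (\<lambda>i. e (Suc i)) \<otimes> t (\<lambda>i. e (Suc i)))"
  proof (rule group_definable_subst[where P = "\<lambda>e x. e 0 = x \<otimes> t (\<lambda>i. e (Suc i))"])
    show "group_definable (\<lambda>e. e (Suc 0) = e 0 \<otimes> t (\<lambda>i. e (Suc (Suc i))))"
      by (rule group_definable_subst[where P = "\<lambda>e y. e (Suc 0) = e 0 \<otimes> y"])
        (intro definable_term_reindex[OF t] group_definable_mult_var)+
  qed (rule definable_term_reindex[OF s])
  then show ?thesis using s t by (auto simp: definable_term_def)
qed

lemma definable_term_inv:
  assumes "definable_term t" shows "definable_term (\<lambda>e. inv (t e))"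
proof -
  have "group_definable (\<lambda>e. e 0 \<otimes> t (\<lambda>i. e (Suc i)) = \<one>)"
    by (intro group_definable_eq definable_term_mult[OF definable_term_var]
        definable_term_reindex[OF assms, of Suc] definable_term_const one_closed)
  then have "group_definable (\<lambda>e. e 0 = inv (t (\<lambda>i. e (Suc i))))"
  proof (rule group_definable_cong[rotated])
    fix e :: "nat \<Rightarrow> 'c" assume e: "range e \<subseteq> carrier G"
    then have "t (\<lambda>i. e (Suc i)) \<in> carrier G" by (intro definable_term_closed[OF assms]) auto
    then show "(e 0 \<otimes> t (\<lambda>i. e (Suc i)) = \<one>) = (e 0 = inv t (\<lambda>i. e (Suc i)))"
      using e by (auto intro!: inv_equality[symmetric] l_inv)
  qed
  then show ?thesis using assms by (auto simp: definable_term_def)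
qed

lemmas group_definable_intros =
  group_definable_conj group_definable_ex group_definable_mem group_definable_eq
  definable_term_var definable_term_const definable_term_mult definable_term_inv

lemma def_set_Collect:
  assumes "group_definable (\<lambda>e. P (e 0))"
  shows "def_set S {g \<in> carrier G. P g}"
proof -
  obtain Q where Q: "definable_predicate (base S) Q"
    "\<And>e. range e \<subseteq> dom (pres S) \<Longrightarrow> Q e \<longleftrightarrow> P (the (pres S (e 0)))"
    by (rule group_definableE[OF assms]) (rule that, assumption, simp)
  let ?D = "{[x] | x. x \<in> dom (pres S)}"
  have "definable (base S) 1 {[x] | x. x \<in> universe (base S) \<and> [x] \<in> ?D \<and> Q (\<lambda>_. x)}"
    by (intro definable1_of_uniformly_definable uniformly_definable_conj
        uniformly_definable_reindex[OF Q(1), of "\<lambda>_. 0"]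
        definable_predicate_in1[OF universe_nonempty definable_dom])
  also have "{[x] | x. x \<in> universe (base S) \<and> [x] \<in> ?D \<and> Q (\<lambda>_. x)} =
      {[x] | x. pres S x \<in> Some ` {g \<in> carrier G. P g}}"
  proof -
    have "x \<in> universe (base S) \<and> [x] \<in> ?D \<and> Q (\<lambda>_. x) \<longleftrightarrow>
        pres S x \<in> Some ` {g \<in> carrier G. P g}" for x
    proof (cases "pres S x")
      case (Some g)
      then have "x \<in> dom (pres S)" "g \<in> carrier G" using pres_closed by auto
      then show ?thesis using Q(2)[of "\<lambda>_. x"] dom_pres Some by auto
    qed auto
    then show ?thesis by simp
  qed
  finally show ?thesis unfolding def_set_def using ran_pres by simp
qed

lemma definable2_Collect:
  assumes "group_definable (\<lambda>e. P (e 0) (e 1))"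
  shows "definable (base S) 2
    {[x, y] | x y. \<exists>g h. pres S x = Some g \<and> pres S y = Some h \<and> P g h}"
proof -
  obtain Q where Q: "definable_predicate (base S) Q"
    "\<And>e. range e \<subseteq> dom (pres S) \<Longrightarrow> Q e \<longleftrightarrow> P (the (pres S (e 0))) (the (pres S (e 1)))"
    by (rule group_definableE[OF assms]) (rule that, assumption, simp)
  let ?D = "{[x] | x. x \<in> dom (pres S)}"
  let ?e = "\<lambda>x y i. if i = 0 then x else y"
  have "(\<lambda>i. e (if i = 0 then 0 else 1)) = (?e (e 0) (e 1) :: nat \<Rightarrow> 'a)" for e :: "nat \<Rightarrow> 'a"
    by auto
  then have "definable_predicate (base S) (\<lambda>e. Q (?e (e 0) (e 1)))"
    using uniformly_definable_reindex[OF Q(1), of "\<lambda>i. if i = 0 then 0 else 1"] by simp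
  then have "definable (base S) 2 {[x, y] | x y. x \<in> universe (base S) \<and> y \<in> universe (base S) \<and>
      [x] \<in> ?D \<and> [y] \<in> ?D \<and> Q (?e x y)}"
    by (intro definable2_of_uniformly_definable uniformly_definable_conj
        definable_predicate_in1[OF universe_nonempty definable_dom])
  also have "{[x, y] | x y. x \<in> universe (base S) \<and> y \<in> universe (base S) \<and>
      [x] \<in> ?D \<and> [y] \<in> ?D \<and> Q (?e x y)} =
      {[x, y] | x y. \<exists>g h. pres S x = Some g \<and> pres S y = Some h \<and> P g h}"
  proof -
    have *: "Q (?e x y) \<longleftrightarrow> P (the (pres S x)) (the (pres S y))"
      if "x \<in> dom (pres S)" "y \<in> dom (pres S)" for x y
      using Q(2)[of "?e x y"] that by auto
    then have "x \<in> universe (base S) \<and> y \<in> universe (base S) \<and> [x] \<in> ?D \<and> [y] \<in> ?D \<and> Q (?e x y) \<longleftrightarrow>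
        (\<exists>g h. pres S x = Some g \<and> pres S y = Some h \<and> P g h)" for x y
    proof (cases "x \<in> dom (pres S) \<and> y \<in> dom (pres S)")
      case True
      then obtain g h where "pres S x = Some g" "pres S y = Some h" by auto
      moreover from True have "Q (?e x y) \<longleftrightarrow> P (the (pres S x)) (the (pres S y))"
        by (simp only: *)
      ultimately show ?thesis using dom_pres by auto
    qed auto
    then show ?thesis by simp
  qed
  finally show ?thesis .
qed

end

section \<open>Morley rank, chain conditions and definable bijections\<close>

lemma morley_ge_mono: "morley_ge N E n Z \<Longrightarrow> Z \<subseteq> Z' \<Longrightarrow> morley_ge N E n Z'"
proof (cases n)
  case (Suc m)
  assume "morley_ge N E n Z" "Z \<subseteq> Z'"
  then show ?thesis unfolding Suc morley_ge.simps by (meson order_trans)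
qed auto

lemma definable_lists:
  "definable M k T \<Longrightarrow> xs \<in> T \<Longrightarrow> length xs = k \<and> set xs \<subseteq> universe M"
  by (auto simp: definable_def defined_set_def)

text \<open>The conditions say that \<open>R\<close> assigns disjoint nonempty unions of \<open>E'\<close>-classes to the
  \<open>E\<close>-classes of \<open>Z\<close>; so it maps disjoint \<open>E\<close>-closed sets to disjoint \<open>E'\<close>-closed ones, and a
  splitting that witnesses the rank of a subset of \<open>Z\<close> is mapped to one for its image.\<close>

lemma morley_ge_image:
  assumes ne: "universe N \<noteq> {}" and R: "definable N 2 R"
    and total: "\<And>x. [x] \<in> Z \<Longrightarrow> \<exists>y. [x, y] \<in> R"
    and inj: "\<And>x x' y. [x, y] \<in> R \<Longrightarrow> [x', y] \<in> R \<Longrightarrow> [x, x'] \<in> E"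
    and closed: "\<And>x y y'. [x, y] \<in> R \<Longrightarrow> [y, y'] \<in> E' \<Longrightarrow> [x, y'] \<in> R"
    and Z: "\<And>zs. zs \<in> Z \<Longrightarrow> length zs = 1"
  shows "morley_ge N E n Y \<Longrightarrow> Y \<subseteq> Z \<Longrightarrow> morley_ge N E' n {[y] | y. \<exists>x. [x] \<in> Y \<and> [x, y] \<in> R}"
proof (induction n arbitrary: Y)
  case 0
  then obtain zs where "zs \<in> Y" "length zs = 1" using Z by auto
  then obtain x where "[x] \<in> Y" by (auto simp: length_Suc_conv)
  then show ?case using total 0 by fastforce
next
  case (Suc n)
  let ?im = "\<lambda>Y. {[y] | y. \<exists>x. [x] \<in> Y \<and> [x, y] \<in> R}"
  from Suc.prems(1) obtain W :: "nat \<Rightarrow> 'a list set" where W: "disjoint_family W"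
    and Wd: "\<And>i. definable N 1 (W i)" and WY: "\<And>i. W i \<subseteq> Y"
    and WE: "\<And>i x y. [x] \<in> W i \<Longrightarrow> [x, y] \<in> E \<Longrightarrow> [y] \<in> W i"
    and Wr: "\<And>i. morley_ge N E n (W i)"
    by auto
  have Vd: "definable N 1 (?im (W i))" for i
  proof -
    have "definable_predicate N (\<lambda>e. \<exists>x\<in>universe N. [case_nat x e 0] \<in> W i \<and>
        [case_nat x e 0, case_nat x e (Suc 0)] \<in> R)"
      by (intro definable_predicate_ex[where Q = "\<lambda>e. [e 0] \<in> W i \<and> [e 0, e (Suc 0)] \<in> R"]
          uniformly_definable_conj definable_predicate_in1[OF ne Wd]
          definable_predicate_in2[OF ne R])
    then have "definable N 1 {[y] | y. y \<in> universe N \<and> (\<exists>x\<in>universe N. [x] \<in> W i \<and> [x, y] \<in> R)}"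
      by (intro definable1_of_uniformly_definable) simp
    also have "{[y] | y. y \<in> universe N \<and> (\<exists>x\<in>universe N. [x] \<in> W i \<and> [x, y] \<in> R)} = ?im (W i)"
      using definable_lists[OF R] by fastforce
    finally show ?thesis .
  qed
  have V: "disjoint_family (\<lambda>i. ?im (W i))"
    unfolding disjoint_family_on_def
  proof (intro ballI impI)
    fix i j :: nat assume "i \<noteq> j"
    then have "W i \<inter> W j = {}" using W by (auto simp: disjoint_family_on_def)
    then show "?im (W i) \<inter> ?im (W j) = {}" using inj WE by blast
  qed
  have VY: "?im (W i) \<subseteq> ?im Y" for i using WY by blast
  have VE: "[y'] \<in> ?im (W i)" if "[y] \<in> ?im (W i)" "[y, y'] \<in> E'" for i y y'
    using that closed by blast
  have Vr: "morley_ge N E' n (?im (W i))" for i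
    by (rule Suc.IH[OF Wr order_trans[OF WY Suc.prems(2)]])
  show ?case
    unfolding morley_ge.simps
  proof (intro exI[of _ "\<lambda>i. ?im (W i)"] conjI allI)
    show "[x] \<in> ?im (W i) \<and> [x, y] \<in> E' \<longrightarrow> [y] \<in> ?im (W i)" for i x y
      by (rule impI, elim conjE) (rule VE)
  qed (fact V Vd VY Vr)+
qed

text \<open>The conditions on \<open>R\<close> in \<open>morley_ge_image\<close> are first-order, so it suffices to require them in
  the base structure.\<close>

lemma morley_ge_realization_image:
  assumes ext: "elementary_extension M N"
    and def: "definable M 2 R" "definable M 2 E" "definable M 2 E'" "definable M 1 D" "definable M 1 D'"
    and total: "\<And>x. [x] \<in> D \<Longrightarrow> \<exists>y. [x, y] \<in> R"
    and inj: "\<And>x x' y. [x, y] \<in> R \<Longrightarrow> [x', y] \<in> R \<Longrightarrow> [x, x'] \<in> E"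
    and closed: "\<And>x y y'. [x, y] \<in> R \<Longrightarrow> [y, y'] \<in> E' \<Longrightarrow> [x, y'] \<in> R"
    and target: "\<And>x y. [x, y] \<in> R \<Longrightarrow> [y] \<in> D'"
    and rank: "morley_ge N (realization M N 2 E) n (realization M N 1 D)"
  shows "morley_ge N (realization M N 2 E') n (realization M N 1 D')"
proof -
  let ?r = "realization M N"
  have lists: "length xs = k \<and> set xs \<subseteq> universe N" if "definable M k T" "xs \<in> ?r k T" for k T xs
    using definable_lists[OF definable_realization[OF ext]] that by blast
  have ne: "universe N \<noteq> {}" using ext by (auto simp: elementary_extension_def)
  let ?totalNP = "\<lambda>b. \<forall>x\<in>universe (structure_at M N b).
        [x] \<in> realization_at M N 1 D b \<longrightarrow>
        (\<exists>y\<in>universe (structure_at M N b). [x, y] \<in> realization_at M N 2 R b)"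
  have "\<forall>x\<in>universe M. [x] \<in> D \<longrightarrow> (\<exists>y\<in>universe M. [x, y] \<in> R)"
    using total definable_lists[OF def(1)] by fastforce
  moreover have "?totalNP True \<longleftrightarrow> ?totalNP False"
    by (rule uniformly_definable_transfer[OF ext, of "?totalNP"]) (intro uniformly_definable_intros ext def)
  ultimately have totalN: "\<forall>x\<in>universe N. [x] \<in> ?r 1 D \<longrightarrow> (\<exists>y\<in>universe N. [x, y] \<in> ?r 2 R)"
    by (simp only: if_True if_False)
  let ?injNP = "\<lambda>b. \<forall>x\<in>universe (structure_at M N b).
        \<forall>x'\<in>universe (structure_at M N b). \<forall>y\<in>universe (structure_at M N b).
        [x, y] \<in> realization_at M N 2 R b \<longrightarrow> [x', y] \<in> realization_at M N 2 R b \<longrightarrow>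
        [x, x'] \<in> realization_at M N 2 E b"
  have "\<forall>x\<in>universe M. \<forall>x'\<in>universe M. \<forall>y\<in>universe M. [x, y] \<in> R \<longrightarrow> [x', y] \<in> R \<longrightarrow> [x, x'] \<in> E"
    using inj by blast
  moreover have "?injNP True \<longleftrightarrow> ?injNP False"
    by (rule uniformly_definable_transfer[OF ext, of "?injNP"]) (intro uniformly_definable_intros ext def)
  ultimately have injN: "\<forall>x\<in>universe N. \<forall>x'\<in>universe N. \<forall>y\<in>universe N.
      [x, y] \<in> ?r 2 R \<longrightarrow> [x', y] \<in> ?r 2 R \<longrightarrow> [x, x'] \<in> ?r 2 E"
    by (simp only: if_True if_False)
  let ?closedNP = "\<lambda>b. \<forall>x\<in>universe (structure_at M N b).
        \<forall>y\<in>universe (structure_at M N b). \<forall>y'\<in>universe (structure_at M N b).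
        [x, y] \<in> realization_at M N 2 R b \<longrightarrow> [y, y'] \<in> realization_at M N 2 E' b \<longrightarrow>
        [x, y'] \<in> realization_at M N 2 R b"
  have "\<forall>x\<in>universe M. \<forall>y\<in>universe M. \<forall>y'\<in>universe M. [x, y] \<in> R \<longrightarrow> [y, y'] \<in> E' \<longrightarrow> [x, y'] \<in> R"
    using closed by blast
  moreover have "?closedNP True \<longleftrightarrow> ?closedNP False"
    by (rule uniformly_definable_transfer[OF ext, of "?closedNP"]) (intro uniformly_definable_intros ext def)
  ultimately have closedN: "\<forall>x\<in>universe N. \<forall>y\<in>universe N. \<forall>y'\<in>universe N.
      [x, y] \<in> ?r 2 R \<longrightarrow> [y, y'] \<in> ?r 2 E' \<longrightarrow> [x, y'] \<in> ?r 2 R"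
    by (simp only: if_True if_False)
  let ?targetNP = "\<lambda>b. \<forall>x\<in>universe (structure_at M N b).
        \<forall>y\<in>universe (structure_at M N b).
        [x, y] \<in> realization_at M N 2 R b \<longrightarrow> [y] \<in> realization_at M N 1 D' b"
  have "\<forall>x\<in>universe M. \<forall>y\<in>universe M. [x, y] \<in> R \<longrightarrow> [y] \<in> D'"
    using target by blast
  moreover have "?targetNP True \<longleftrightarrow> ?targetNP False"
    by (rule uniformly_definable_transfer[OF ext, of "?targetNP"]) (intro uniformly_definable_intros ext def)
  ultimately have targetN: "\<forall>x\<in>universe N. \<forall>y\<in>universe N. [x, y] \<in> ?r 2 R \<longrightarrow> [y] \<in> ?r 1 D'"
    by (simp only: if_True if_False)
  have "morley_ge N (?r 2 E') n {[y] | y. \<exists>x. [x] \<in> ?r 1 D \<and> [x, y] \<in> ?r 2 R}"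
  proof (rule morley_ge_image[OF ne definable_realization[OF ext def(1)], where Z = "?r 1 D" and E = "?r 2 E"])
    show "\<exists>y. [x, y] \<in> ?r 2 R" if "[x] \<in> ?r 1 D" for x
      using totalN that lists[OF def(4) that] by auto
    show "[x, x'] \<in> ?r 2 E" if "[x, y] \<in> ?r 2 R" "[x', y] \<in> ?r 2 R" for x x' y
      using injN that lists[OF def(1) that(1)] lists[OF def(1) that(2)] by auto
    show "[x, y'] \<in> ?r 2 R" if "[x, y] \<in> ?r 2 R" "[y, y'] \<in> ?r 2 E'" for x y y'
      using closedN that lists[OF def(1) that(1)] lists[OF def(3) that(2)] by auto
    show "length zs = 1" if "zs \<in> ?r 1 D" for zs
      using lists[OF def(4) that] by simp
  qed (use rank in auto)
  moreover have "{[y] | y. \<exists>x. [x] \<in> ?r 1 D \<and> [x, y] \<in> ?r 2 R} \<subseteq> ?r 1 D'"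
  proof -
    have "[y] \<in> ?r 1 D'" if "[x, y] \<in> ?r 2 R" for x y
      using targetN that lists[OF def(1) that] by auto
    then show ?thesis by blast
  qed
  ultimately show ?thesis by (rule morley_ge_mono)
qed

lemma pres_kernel_iff: "[x, y] \<in> pres_kernel S \<longleftrightarrow> x \<in> dom (pres S) \<and> pres S x = pres S y"
  by (auto simp: pres_kernel_def)

text \<open>Here \<open>r\<close> is a union of products of fibres of the two presentations and induces a bijection
  between the presented sets; \<open>morley_ge_realization_image\<close> applies to it and to its
  converse.\<close>

lemma rank_ge_eq_of_definable_bijection:
  assumes ext: "elementary_extension (base S) (ext S)"
    and same: "base S' = base S" "ext S' = ext S"
    and R: "definable (base S) 2 {[x, y] | x y. r x y}"
    and conv: "definable (base S) 2 {[y, x] | x y. r x y}"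
    and kernel: "definable (base S) 2 (pres_kernel S)" "definable (base S) 2 (pres_kernel S')"
    and dom: "definable (base S) 1 {[x] | x. x \<in> dom (pres S)}"
      "definable (base S) 1 {[x] | x. x \<in> dom (pres S')}"
    and r_dom: "\<And>x y. r x y \<Longrightarrow> x \<in> dom (pres S) \<and> y \<in> dom (pres S')"
    and r_left: "\<And>x. x \<in> dom (pres S) \<Longrightarrow> \<exists>y. r x y"
    and r_right: "\<And>y. y \<in> dom (pres S') \<Longrightarrow> \<exists>x. r x y"
    and r_inj: "\<And>x x' y. r x y \<Longrightarrow> r x' y \<Longrightarrow> pres S x = pres S x'"
    and r_fun: "\<And>x y y'. r x y \<Longrightarrow> r x y' \<Longrightarrow> pres S' y = pres S' y'"
    and r_cong: "\<And>x x' y. r x y \<Longrightarrow> pres S x = pres S x' \<Longrightarrow> r x' y"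
      "\<And>x y y'. r x y \<Longrightarrow> pres S' y = pres S' y' \<Longrightarrow> r x y'"
  shows "rank_ge S n \<longleftrightarrow> rank_ge S' n"
proof
  assume "rank_ge S n"
  then show "rank_ge S' n"
    unfolding rank_ge_def same
  proof (rule morley_ge_realization_image[OF ext R kernel dom, rotated -1])
    fix x x' y y'
    show "\<exists>y. [x, y] \<in> {[x, y] | x y. r x y}" if "[x] \<in> {[x] | x. x \<in> dom (pres S)}"
      using that r_left by simp
    show "[x, x'] \<in> pres_kernel S" if "[x, y] \<in> {[x, y] | x y. r x y}" "[x', y] \<in> {[x, y] | x y. r x y}"
      using that r_dom[of x y] r_inj[of x y x'] by (simp add: pres_kernel_iff)
    show "[x, y'] \<in> {[x, y] | x y. r x y}" if "[x, y] \<in> {[x, y] | x y. r x y}" "[y, y'] \<in> pres_kernel S'"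
      using that r_cong(2)[of x y y'] by (simp add: pres_kernel_iff)
    show "[y] \<in> {[x] | x. x \<in> dom (pres S')}" if "[x, y] \<in> {[x, y] | x y. r x y}"
      using that r_dom by simp
  qed
next
  assume "rank_ge S' n"
  then show "rank_ge S n"
    unfolding rank_ge_def same
  proof (rule morley_ge_realization_image[OF ext conv kernel(2,1) dom(2,1), rotated -1])
    fix x x' y y'
    show "\<exists>x. [y, x] \<in> {[y, x] | x y. r x y}" if "[y] \<in> {[x] | x. x \<in> dom (pres S')}"
      using that r_right by simp
    show "[y, y'] \<in> pres_kernel S'" if "[y, x] \<in> {[y, x] | x y. r x y}" "[y', x] \<in> {[y, x] | x y. r x y}"
      using that r_dom[of x y] r_fun[of x y y'] by (simp add: pres_kernel_iff)
    show "[y, x'] \<in> {[y, x] | x y. r x y}" if "[y, x] \<in> {[y, x] | x y. r x y}" "[x, x'] \<in> pres_kernel S"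
      using that r_cong(1)[of x y x'] by (simp add: pres_kernel_iff)
    show "[x] \<in> {[x] | x. x \<in> dom (pres S)}" if "[y, x] \<in> {[y, x] | x y. r x y}"
      using that r_dom by simp
  qed
qed

context fmr
begin

definition preimage :: "'c set \<Rightarrow> 'a list set" where
  "preimage X = {[x] | x. pres S x \<in> Some ` X}"

abbreviation rank_at_least :: "nat \<Rightarrow> 'c set \<Rightarrow> bool" where
  "rank_at_least n X \<equiv> morley_ge (ext S) (realization (base S) (ext S) 2 (pres_kernel S)) n
     (realization (base S) (ext S) 1 (preimage X))"

lemma preimage_iff: "[x] \<in> preimage X \<longleftrightarrow> pres S x \<in> Some ` X"
  by (simp add: preimage_def)

lemma def_set_iff: "def_set S X \<longleftrightarrow> X \<subseteq> carrier G \<and> definable (base S) 1 (preimage X)"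
  by (simp add: def_set_def preimage_def ran_pres)

lemma rank_ge_iff: "rank_ge S n \<longleftrightarrow> rank_at_least n (carrier G)"
proof -
  have "pres S x \<in> Some ` carrier G \<longleftrightarrow> x \<in> dom (pres S)" for x
    using pres_closed by (cases "pres S x") auto
  then show ?thesis by (simp add: rank_ge_def preimage_def)
qed

text \<open>Inclusion, disjointness, invariance under the presentation and nonemptiness of definable sets
  are expressed by sentences; therefore the realizations of cosets of definable subgroups can witness the
  rank in the extension, although the cosets are chosen in the base structure.\<close>

lemma realization_preimage_mono:
  assumes X: "def_set S X" and Y: "def_set S Y" and XY: "X \<subseteq> Y"
  shows "realization (base S) (ext S) 1 (preimage X) \<subseteq> realization (base S) (ext S) 1 (preimage Y)"
proof -
  let ?M = "base S" and ?N = "ext S"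
  note def = X[unfolded def_set_iff, THEN conjunct2] Y[unfolded def_set_iff, THEN conjunct2]
  let ?P = "\<lambda>b. \<forall>x\<in>universe (structure_at ?M ?N b).
    [x] \<in> realization_at ?M ?N 1 (preimage X) b \<longrightarrow> [x] \<in> realization_at ?M ?N 1 (preimage Y) b"
  have "\<forall>x\<in>universe ?M. [x] \<in> preimage X \<longrightarrow> [x] \<in> preimage Y"
    using XY by (auto simp: preimage_iff)
  moreover have "?P True \<longleftrightarrow> ?P False"
    by (rule uniformly_definable_transfer[OF elementary, of ?P])
      (intro uniformly_definable_intros elementary def)
  ultimately have *: "\<forall>x\<in>universe ?N. [x] \<in> realization ?M ?N 1 (preimage X) \<longrightarrow>
      [x] \<in> realization ?M ?N 1 (preimage Y)"
    by (simp only: if_True if_False)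
  show ?thesis
  proof
    fix xs assume xs: "xs \<in> realization ?M ?N 1 (preimage X)"
    then obtain x where "xs = [x]" "x \<in> universe ?N"
      using definable_lists[OF definable_realization[OF elementary def(1)] xs]
      by (auto simp: length_Suc_conv)
    then show "xs \<in> realization ?M ?N 1 (preimage Y)" using * xs by blast
  qed
qed

lemma realization_preimage_disjoint:
  assumes X: "def_set S X" and Y: "def_set S Y" and XY: "X \<inter> Y = {}"
  shows "realization (base S) (ext S) 1 (preimage X) \<inter> realization (base S) (ext S) 1 (preimage Y) = {}"
proof -
  let ?M = "base S" and ?N = "ext S"
  note def = X[unfolded def_set_iff, THEN conjunct2] Y[unfolded def_set_iff, THEN conjunct2]
  let ?P = "\<lambda>b. \<forall>x\<in>universe (structure_at ?M ?N b).
    [x] \<in> realization_at ?M ?N 1 (preimage X) b \<longrightarrow> \<not> [x] \<in> realization_at ?M ?N 1 (preimage Y) b"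
  have "\<forall>x\<in>universe ?M. [x] \<in> preimage X \<longrightarrow> \<not> [x] \<in> preimage Y"
    using XY by (auto simp: preimage_iff)
  moreover have "?P True \<longleftrightarrow> ?P False"
    by (rule uniformly_definable_transfer[OF elementary, of ?P])
      (intro uniformly_definable_intros elementary def)
  ultimately have *: "\<forall>x\<in>universe ?N. [x] \<in> realization ?M ?N 1 (preimage X) \<longrightarrow>
      \<not> [x] \<in> realization ?M ?N 1 (preimage Y)"
    by (simp only: if_True if_False)
  show ?thesis
  proof (rule ccontr)
    assume "\<not> ?thesis"
    then obtain xs where xs: "xs \<in> realization ?M ?N 1 (preimage X)"
      "xs \<in> realization ?M ?N 1 (preimage Y)" by blast
    then obtain x where "xs = [x]" "x \<in> universe ?N"
      using definable_lists[OF definable_realization[OF elementary def(1)] xs(1)]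
      by (auto simp: length_Suc_conv)
    then show False using * xs by blast
  qed
qed

lemma realization_preimage_closed:
  assumes X: "def_set S X" and x: "[x] \<in> realization (base S) (ext S) 1 (preimage X)"
    and xy: "[x, y] \<in> realization (base S) (ext S) 2 (pres_kernel S)"
  shows "[y] \<in> realization (base S) (ext S) 1 (preimage X)"
proof -
  let ?M = "base S" and ?N = "ext S"
  note def = X[unfolded def_set_iff, THEN conjunct2] definable_kernel
  let ?P = "\<lambda>b. \<forall>x\<in>universe (structure_at ?M ?N b). \<forall>y\<in>universe (structure_at ?M ?N b).
    [x] \<in> realization_at ?M ?N 1 (preimage X) b \<longrightarrow>
    [x, y] \<in> realization_at ?M ?N 2 (pres_kernel S) b \<longrightarrow>
    [y] \<in> realization_at ?M ?N 1 (preimage X) b"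
  have "\<forall>x\<in>universe ?M. \<forall>y\<in>universe ?M. [x] \<in> preimage X \<longrightarrow> [x, y] \<in> pres_kernel S \<longrightarrow>
      [y] \<in> preimage X"
    by (metis preimage_iff pres_kernel_iff)
  moreover have "?P True \<longleftrightarrow> ?P False"
    by (rule uniformly_definable_transfer[OF elementary, of ?P])
      (intro uniformly_definable_intros elementary def)
  ultimately have "\<forall>x\<in>universe ?N. \<forall>y\<in>universe ?N. [x] \<in> realization ?M ?N 1 (preimage X) \<longrightarrow>
      [x, y] \<in> realization ?M ?N 2 (pres_kernel S) \<longrightarrow> [y] \<in> realization ?M ?N 1 (preimage X)"
    by (simp only: if_True if_False)
  moreover have "x \<in> universe ?N" "y \<in> universe ?N"
    using definable_lists[OF definable_realization[OF elementary def(2)] xy] by auto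
  ultimately show ?thesis using x xy by blast
qed

lemma realization_preimage_nonempty:
  assumes X: "def_set S X" and g: "g \<in> X"
  shows "realization (base S) (ext S) 1 (preimage X) \<noteq> {}"
proof -
  let ?M = "base S" and ?N = "ext S"
  note def = X[unfolded def_set_iff, THEN conjunct2]
  let ?P = "\<lambda>b. \<exists>x\<in>universe (structure_at ?M ?N b). [x] \<in> realization_at ?M ?N 1 (preimage X) b"
  have "g \<in> carrier G" using X g by (auto simp: def_set_iff)
  then obtain x where "pres S x = Some g" by (rule pres_surj)
  then have "\<exists>x\<in>universe ?M. [x] \<in> preimage X"
    using g dom_pres by (intro bexI[of _ x]) (auto simp: preimage_iff)
  moreover have "?P True \<longleftrightarrow> ?P False"
    by (rule uniformly_definable_transfer[OF elementary, of ?P])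
      (intro uniformly_definable_intros elementary def)
  ultimately have "\<exists>x\<in>universe ?N. [x] \<in> realization ?M ?N 1 (preimage X)"
    by (simp only: if_True if_False)
  then show ?thesis by blast
qed

text \<open>If a set of level \<open>n + 1\<close> always contains infinitely many disjoint sets of level \<open>n\<close>,
  then a set of level \<open>n\<close> has rank at least \<open>n\<close>; so finite rank bounds the levels.  Both chain
  conditions below follow by letting the sets be cosets.\<close>

lemma levels_bounded:
  assumes def: "\<And>n X. P n X \<Longrightarrow> def_set S X \<and> X \<noteq> {}"
    and split: "\<And>n X. P (Suc n) X \<Longrightarrow>
        \<exists>Y :: nat \<Rightarrow> 'c set. disjoint_family Y \<and> (\<forall>i. Y i \<subseteq> X \<and> P n (Y i))"
  shows "\<exists>n. \<forall>X. \<not> P n X"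
proof -
  let ?R = "\<lambda>X. realization (base S) (ext S) 1 (preimage X)"
  let ?E = "realization (base S) (ext S) 2 (pres_kernel S)"
  have rank: "P n X \<Longrightarrow> rank_at_least n X" for n X
  proof (induction n arbitrary: X)
    case 0
    then show ?case using def[of 0 X] realization_preimage_nonempty by auto
  next
    case (Suc n)
    obtain Y :: "nat \<Rightarrow> 'c set" where Y: "disjoint_family Y" "\<And>i. Y i \<subseteq> X" "\<And>i. P n (Y i)"
      using split[OF Suc.prems] by blast
    have Yd: "def_set S (Y i)" for i using def[OF Y(3)] by blast
    have Xd: "def_set S X" using def[OF Suc.prems] by blast
    have "definable (ext S) 1 (?R (Y i))" for i
      using definable_realization[OF elementary] Yd def_set_iff by blast
    moreover have "?R (Y i) \<subseteq> ?R X" for i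
      by (rule realization_preimage_mono[OF Yd Xd Y(2)])
    moreover have "[x] \<in> ?R (Y i) \<and> [x, y] \<in> ?E \<longrightarrow> [y] \<in> ?R (Y i)" for i x y
      using realization_preimage_closed[OF Yd] by blast
    moreover have "disjoint_family (\<lambda>i. ?R (Y i))"
      using Y(1) realization_preimage_disjoint[OF Yd Yd] by (simp add: disjoint_family_on_def)
    moreover have "rank_at_least n (Y i)" for i by (rule Suc.IH[OF Y(3)])
    ultimately show ?case unfolding morley_ge.simps
      by (intro exI[of _ "\<lambda>i. ?R (Y i)"] conjI allI) assumption+
  qed
  obtain n where n: "\<not> rank_ge S n" using fmr by (auto simp: fmr_group_def)
  have "\<not> P n X" for X
  proof
    assume "P n X"
    then have X: "def_set S X" and r: "rank_at_least n X" using def rank by blast+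
    have "def_set S (carrier G)"
      using def_set_Collect[OF group_definable_eq_var] by simp
    moreover have "X \<subseteq> carrier G" using X by (simp add: def_set_iff)
    ultimately have "rank_at_least n (carrier G)"
      by (rule morley_ge_mono[OF r realization_preimage_mono[OF X]])
    then show False using n rank_ge_iff by blast
  qed
  then show ?thesis by blast
qed

end

section \<open>Chain conditions on definable subgroups\<close>

lemma (in group) mem_rcos_iff:
  assumes "subgroup K G" "g \<in> carrier G"
  shows "u \<in> K #> g \<longleftrightarrow> u \<in> carrier G \<and> u \<otimes> inv g \<in> K"
  using subgroup.rcos_module[OF assms(1) is_group assms(2)]
    r_coset_subset_G[OF subgroup.subset[OF assms(1)] assms(2)] by blast

lemma (in group) rcos_eq_iff:
  assumes K: "subgroup K G" and ab: "a \<in> carrier G" "b \<in> carrier G"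
  shows "K #> a = K #> b \<longleftrightarrow> a \<otimes> inv b \<in> K"
  using repr_independence[OF _ ab(2) K] rcos_self[OF ab(1) K] mem_rcos_iff[OF K ab(2)] ab by metis

lemma (in group) rcos_absorb:
  assumes "subgroup K G" "x \<in> K" "g \<in> carrier G"
  shows "K #> (x \<otimes> g) = K #> g"
  using coset_mult_assoc[OF subgroup.subset[OF assms(1)], of x g] coset_join2[of x K] assms
    subgroup.subset[OF assms(1)] by auto

lemma (in group) rcos_cancel:
  assumes "K \<subseteq> carrier G" "a \<in> carrier G" "b \<in> carrier G" "g \<in> carrier G"
    and "K #> (a \<otimes> g) = K #> (b \<otimes> g)"
  shows "K #> a = K #> b"
proof -
  have "K #> (c \<otimes> g) #> inv g = K #> c" if "c \<in> carrier G" for c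
    using assms(1,4) that by (simp add: coset_mult_assoc m_assoc)
  then show ?thesis using assms by metis
qed

lemma rcosets_restrict: "rcosets\<^bsub>G\<lparr>carrier := A\<rparr>\<^esub> B = (\<lambda>a. B #>\<^bsub>G\<^esub> a) ` A"
  by (auto simp: RCOSETS_def)

text \<open>Any map with finite range that separates the cosets of \<open>B\<close> bounds their number.\<close>

lemma (in group) finite_rcosetsI:
  assumes B: "subgroup B G" and A: "A \<subseteq> carrier G" and fin: "finite (c ` A)"
    and sep: "\<And>a b. a \<in> A \<Longrightarrow> b \<in> A \<Longrightarrow> c a = c b \<Longrightarrow> a \<otimes> inv b \<in> B"
  shows "finite (rcosets\<^bsub>G\<lparr>carrier := A\<rparr>\<^esub> B)"
proof -
  define s where "s t = (SOME a. a \<in> A \<and> c a = t)" for t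
  have "B #> a = B #> s (c a)" if "a \<in> A" for a
  proof -
    have "s (c a) \<in> A \<and> c (s (c a)) = c a"
      unfolding s_def by (rule someI[of _ a]) (simp add: that)
    then show ?thesis using sep[of a "s (c a)"] that A B by (subst rcos_eq_iff) auto
  qed
  then have "rcosets\<^bsub>G\<lparr>carrier := A\<rparr>\<^esub> B \<subseteq> (\<lambda>t. B #> s t) ` (c ` A)"
    unfolding rcosets_restrict by blast
  then show ?thesis using fin by (meson finite_imageI finite_subset)
qed

context fmr
begin

lemma def_subgroupD: "def_subgroup S G K \<Longrightarrow> subgroup K G" "def_subgroup S G K \<Longrightarrow> def_set S K"
  by (simp_all add: def_subgroup_def)

lemma def_subgroup_subset: "def_subgroup S G K \<Longrightarrow> K \<subseteq> carrier G"
  by (simp add: def_subgroupD subgroup.subset)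

lemma def_set_rcos:
  assumes K: "def_subgroup S G K" and g: "g \<in> carrier G" shows "def_set S (K #> g)"
proof -
  have "def_set S {u \<in> carrier G. u \<otimes> inv g \<in> K}"
    using K g by (intro def_set_Collect group_definable_intros) (auto simp: def_subgroupD)
  moreover have "{u \<in> carrier G. u \<otimes> inv g \<in> K} = K #> g"
    using mem_rcos_iff K g by (auto simp: def_subgroupD)
  ultimately show ?thesis by simp
qed

text \<open>The coset \<open>K i #> g\<close> contains the cosets \<open>K (i + j + 1) #> (x\<^sub>j \<otimes> g)\<close> for
  \<open>x\<^sub>j \<in> K (i + j) - K (i + j + 1)\<close>.  These are disjoint, the later ones being inside
  \<open>K (i + j + 1) #> g\<close>.  So every coset of every \<open>K i\<close> has every level.\<close>

lemma no_descending_chain: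
  assumes K: "\<And>i::nat. def_subgroup S G (K i)" and less: "\<And>i. K (Suc i) \<subset> K i"
  shows False
proof -
  let ?P = "\<lambda>(_::nat) X. \<exists>i. \<exists>g\<in>carrier G. X = K i #> g"
  have anti: "K j \<subseteq> K i" if "i \<le> j" for i j
    using that by (induction rule: dec_induct) (use less in blast)+
  note sub = def_subgroupD(1)[OF K] and carr = def_subgroup_subset[OF K, THEN subsetD]
  have "\<exists>n. \<forall>X. \<not> ?P n X"
  proof (rule levels_bounded)
    fix n X assume "?P n X"
    then obtain i g where "g \<in> carrier G" "X = K i #> g" by blast
    then show "def_set S X \<and> X \<noteq> {}" using def_set_rcos[OF K] rcos_self[OF _ sub] by blast
  next
    fix n X assume "?P (Suc n) X"
    then obtain i g where g: "g \<in> carrier G" and X: "X = K i #> g" by blast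
    have "\<forall>j. \<exists>x. x \<in> K (i + j) \<and> x \<notin> K (Suc (i + j))" using less by blast
    then obtain x where x: "\<And>j. x j \<in> K (i + j)" "\<And>j. x j \<notin> K (Suc (i + j))" by metis
    note xc = carr[OF x(1)]
    define Y where "Y j = K (Suc (i + j)) #> (x j \<otimes> g)" for j
    have YK: "Y j \<subseteq> K l #> g" if "l \<le> i + j" for j l
    proof -
      have "Y j \<subseteq> K l #> (x j \<otimes> g)"
        unfolding Y_def r_coset_def using anti[of l "Suc (i + j)"] that by auto
      moreover have "x j \<in> K l" using anti[OF that] x(1) by blast
      ultimately show ?thesis using rcos_absorb[OF sub _ g] by metis
    qed
    have disj: "Y j \<inter> Y l = {}" if "j < l" for j l
    proof (rule ccontr)
      let ?L = "K (Suc (i + j))"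
      assume "Y j \<inter> Y l \<noteq> {}"
      then obtain u where u: "u \<in> Y j" "u \<in> Y l" by blast
      then have "u \<in> ?L #> g" using YK[of "Suc (i + j)" l] that by auto
      then have "?L #> g = ?L #> u" using repr_independence[OF _ g sub] by metis
      also have "\<dots> = ?L #> (x j \<otimes> g)"
        using u(1) repr_independence[OF _ _ sub] xc g unfolding Y_def by (metis m_closed)
      finally have "x j \<otimes> g \<otimes> inv g \<in> ?L" using rcos_eq_iff[OF sub, of "x j \<otimes> g" g] xc g by auto
      then show False using x(2) xc g by (simp add: m_assoc)
    qed
    then have "disjoint_family Y"
      unfolding disjoint_family_on_def by (metis inf_commute nat_neq_iff)
    moreover have "Y j \<subseteq> X" for j unfolding X by (rule YK) simp
    moreover have "?P n (Y j)" for j unfolding Y_def using xc g by blast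
    ultimately show "\<exists>Y :: nat \<Rightarrow> 'c set. disjoint_family Y \<and> (\<forall>i. Y i \<subseteq> X \<and> ?P n (Y i))"
      by blast
  qed
  then show False using one_closed by blast
qed

lemma connected_subgroup_infinite_index:
  assumes "connected_subgroup S G L" "def_subgroup S G K" "K \<subset> L"
  shows "infinite ((\<lambda>a. K #> a) ` L)"
  using assms by (auto simp: connected_subgroup_def rcosets_restrict)

text \<open>By connectedness \<open>K n\<close> has infinite index in \<open>K (n + 1)\<close>, so a coset of \<open>K (n + 1)\<close> splits into
  infinitely many cosets of \<open>K n\<close>: cosets of \<open>K n\<close> have level \<open>n\<close>.\<close>

lemma no_ascending_connected_chain:
  assumes K: "\<And>i::nat. def_subgroup S G (K i)" and conn: "\<And>i. connected_subgroup S G (K i)"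
    and less: "\<And>i. K i \<subset> K (Suc i)"
  shows False
proof -
  let ?P = "\<lambda>(n::nat) X. \<exists>g\<in>carrier G. X = K n #> g"
  note sub = def_subgroupD(1)[OF K] and carr = def_subgroup_subset[OF K, THEN subsetD]
  have "\<exists>n. \<forall>X. \<not> ?P n X"
  proof (rule levels_bounded)
    fix n X assume "?P n X"
    then obtain g where "g \<in> carrier G" "X = K n #> g" by blast
    then show "def_set S X \<and> X \<noteq> {}" using def_set_rcos[OF K] rcos_self[OF _ sub] by blast
  next
    fix n X assume "?P (Suc n) X"
    then obtain g where g: "g \<in> carrier G" and X: "X = K (Suc n) #> g" by blast
    have "infinite ((\<lambda>a. K n #> a) ` K (Suc n))"
      by (rule connected_subgroup_infinite_index[OF conn K less])
    then obtain f :: "nat \<Rightarrow> 'c set" where f: "inj f" "range f \<subseteq> (\<lambda>a. K n #> a) ` K (Suc n)"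
      using infinite_countable_subset by blast
    then have "\<forall>i. \<exists>a. a \<in> K (Suc n) \<and> f i = K n #> a" by blast
    then obtain a where a: "\<And>i. a i \<in> K (Suc n)" "\<And>i. f i = K n #> a i" by metis
    note ac = carr[OF a(1)]
    define Y where "Y i = K n #> (a i \<otimes> g)" for i
    have "Y i \<inter> Y j = {}" if "i \<noteq> j" for i j
    proof (rule ccontr)
      assume "Y i \<inter> Y j \<noteq> {}"
      then obtain u where u: "u \<in> Y i" "u \<in> Y j" by blast
      then have "K n #> (a i \<otimes> g) = K n #> (a j \<otimes> g)"
        using repr_independence[OF _ _ sub] ac g unfolding Y_def by (metis m_closed)
      then have "K n #> a i = K n #> a j"
        by (rule rcos_cancel[OF def_subgroup_subset[OF K] ac ac g])
      then show False using f(1) that a(2) by (metis injD)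
    qed
    then have "disjoint_family Y" by (auto simp: disjoint_family_on_def)
    moreover have "Y i \<subseteq> X" for i
    proof -
      have "Y i \<subseteq> K (Suc n) #> (a i \<otimes> g)" using less[of n] by (auto simp: Y_def r_coset_def)
      then show ?thesis using rcos_absorb[OF sub a(1) g] X by simp
    qed
    moreover have "?P n (Y i)" for i unfolding Y_def using ac g by blast
    ultimately show "\<exists>Y :: nat \<Rightarrow> 'c set. disjoint_family Y \<and> (\<forall>i. Y i \<subseteq> X \<and> ?P n (Y i))"
      by blast
  qed
  then show False using one_closed by blast
qed

lemma ex_minimal_def_subgroup:
  assumes Q: "\<And>K. Q K \<Longrightarrow> def_subgroup S G K" and K0: "Q K0"
  obtains K where "Q K" "\<And>B. Q B \<Longrightarrow> B \<subseteq> K \<Longrightarrow> B = K"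
proof -
  have "\<exists>K. Q K \<and> (\<forall>B. Q B \<longrightarrow> B \<subseteq> K \<longrightarrow> B = K)"
  proof (rule ccontr)
    assume "\<not> ?thesis"
    then have "\<exists>B. Q B \<and> B \<subset> K" if "Q K" for K using that by blast
    then obtain f :: "nat \<Rightarrow> 'c set" where "\<And>n. Q (f n) \<and> f (Suc n) \<subset> f n"
      using dependent_nat_choice[of "\<lambda>_. Q" "\<lambda>_ K B. B \<subset> K"] K0 by blast
    then show False using no_descending_chain Q by metis
  qed
  then show ?thesis using that by blast
qed

lemma ex_maximal_connected_subgroup:
  assumes Q: "\<And>K. Q K \<Longrightarrow> def_subgroup S G K \<and> connected_subgroup S G K" and K0: "Q K0"
  obtains K where "Q K" "\<And>B. Q B \<Longrightarrow> K \<subseteq> B \<Longrightarrow> B = K"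
proof -
  have "\<exists>K. Q K \<and> (\<forall>B. Q B \<longrightarrow> K \<subseteq> B \<longrightarrow> B = K)"
  proof (rule ccontr)
    assume "\<not> ?thesis"
    then have "\<exists>B. Q B \<and> K \<subset> B" if "Q K" for K using that by blast
    then obtain f :: "nat \<Rightarrow> 'c set" where "\<And>n. Q (f n) \<and> f n \<subset> f (Suc n)"
      using dependent_nat_choice[of "\<lambda>_. Q" "\<lambda>_ K B. K \<subset> B"] K0 by blast
    then show False using no_ascending_connected_chain Q by metis
  qed
  then show ?thesis using that by blast
qed

section \<open>The radical of an indecomposable abelian subgroup\<close>

lemma def_subgroup_trivial: "def_subgroup S G {\<one>}"
proof -
  have "def_set S {g \<in> carrier G. g = \<one>}"
    by (intro def_set_Collect group_definable_intros) simp
  moreover have "{g \<in> carrier G. g = \<one>} = {\<one>}" by auto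
  ultimately show ?thesis by (simp add: def_subgroup_def triv_subgroup)
qed

lemma def_subgroup_Int:
  assumes "def_subgroup S G K" "def_subgroup S G L" shows "def_subgroup S G (K \<inter> L)"
proof -
  have "def_set S {g \<in> carrier G. g \<in> K \<and> g \<in> L}"
    using assms by (intro def_set_Collect group_definable_intros) (auto simp: def_subgroupD)
  moreover have "{g \<in> carrier G. g \<in> K \<and> g \<in> L} = K \<inter> L"
    using assms def_subgroup_subset by blast
  ultimately show ?thesis using assms subgroups_Inter_pair by (simp add: def_subgroup_def)
qed

lemma def_subgroup_set_mult:
  assumes K: "def_subgroup S G K" and L: "def_subgroup S G L"
    and comm: "\<And>k l. k \<in> K \<Longrightarrow> l \<in> L \<Longrightarrow> k \<otimes> l = l \<otimes> k"
  shows "def_subgroup S G (K <#> L)"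
proof -
  note subs = def_subgroup_subset[OF K, THEN subsetD] def_subgroup_subset[OF L, THEN subsetD]
  have "def_set S {g \<in> carrier G. \<exists>k\<in>carrier G. \<exists>l\<in>carrier G. k \<in> K \<and> l \<in> L \<and> g = k \<otimes> l}"
    using assms by (intro def_set_Collect group_definable_intros) (auto simp: def_subgroupD)
  moreover have "{g \<in> carrier G. \<exists>k\<in>carrier G. \<exists>l\<in>carrier G. k \<in> K \<and> l \<in> L \<and> g = k \<otimes> l} = K <#> L"
    using subs by (fastforce simp: set_mult_def)
  moreover have "subgroup (K <#> L) G"
  proof (rule subgroupI)
    note KL = def_subgroupD(1)[OF K] def_subgroupD(1)[OF L]
    show "K <#> L \<subseteq> carrier G" using subs by (auto simp: set_mult_def)
    show "K <#> L \<noteq> {}" using KL[THEN subgroup.one_closed] by (auto simp: set_mult_def)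
    show "inv a \<in> K <#> L" if "a \<in> K <#> L" for a
    proof -
      from that obtain k l where kl: "k \<in> K" "l \<in> L" "a = k \<otimes> l" by (auto simp: set_mult_def)
      then have "inv a = inv k \<otimes> inv l" using subs comm by (metis inv_mult_group)
      then show ?thesis using kl KL[THEN subgroup.m_inv_closed] by (auto simp: set_mult_def)
    qed
    show "a \<otimes> b \<in> K <#> L" if "a \<in> K <#> L" "b \<in> K <#> L" for a b
    proof -
      from that obtain k l k' l' where kl: "k \<in> K" "l \<in> L" "a = k \<otimes> l" "k' \<in> K" "l' \<in> L" "b = k' \<otimes> l'"
        by (auto simp: set_mult_def)
      have "a \<otimes> b = k \<otimes> (l \<otimes> k') \<otimes> l'" using kl subs by (simp add: m_assoc)
      also have "l \<otimes> k' = k' \<otimes> l" by (rule comm[OF kl(4,2), symmetric])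
      finally have "a \<otimes> b = (k \<otimes> k') \<otimes> (l \<otimes> l')" using kl subs by (simp add: m_assoc)
      moreover have "k \<otimes> k' \<in> K" "l \<otimes> l' \<in> L" using kl KL[THEN subgroup.m_closed] by auto
      ultimately show ?thesis unfolding set_mult_def by blast
    qed
  qed
  ultimately show ?thesis by (simp add: def_subgroup_def)
qed

end

lemma radical_eqI:
  assumes "radical_candidate S G A J" and "\<And>B. radical_candidate S G A B \<Longrightarrow> B \<subseteq> J"
  shows "radical S G A = J"
  unfolding radical_def
proof (rule the_equality)
  show "radical_candidate S G A J \<and> (\<forall>B. radical_candidate S G A B \<and> J \<subseteq> B \<longrightarrow> B = J)"
    using assms by blast
qed (use assms in blast)

text \<open>In an indecomposable group no proper definable subgroup has a definable supplement.\<close>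

lemma indecomposable_radical_candidate_iff:
  assumes "indecomposable S G A"
  shows "radical_candidate S G A B \<longleftrightarrow> def_subgroup S G B \<and> B \<subset> A \<and> connected_subgroup S G B"
  using assms unfolding indecomposable_def radical_candidate_def definable_supplement_def by blast

lemma (in group) torsion_free_Mod_iff:
  assumes "J \<lhd> G"
  shows "torsion_free (G Mod J) \<longleftrightarrow> (\<forall>a\<in>carrier G. \<forall>n::nat. n > 0 \<longrightarrow> a [^] n \<in> J \<longrightarrow> a \<in> J)"
proof -
  have sub: "subgroup J G" using assms by (rule normal_imp_subgroup)
  have J: "J #> a = J \<longleftrightarrow> a \<in> J" if "a \<in> carrier G" for a
    using coset_join1 coset_join2 sub that by blast
  show ?thesis
    unfolding torsion_free_def carrier_FactGroup
    using normal.FactGroup_pow[OF assms] J by auto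
qed

lemma (in group) set_mult_increasing:
  assumes K: "subgroup K G" and L: "subgroup L G"
  shows "K \<subseteq> K <#> L" "L \<subseteq> K <#> L"
proof -
  have "k \<otimes> \<one> \<in> K <#> L" if "k \<in> K" for k
    using that subgroup.one_closed[OF L] unfolding set_mult_def by blast
  then show "K \<subseteq> K <#> L" using subgroup.subset[OF K] by fastforce
  have "\<one> \<otimes> l \<in> K <#> L" if "l \<in> L" for l
    using that subgroup.one_closed[OF K] unfolding set_mult_def by blast
  then show "L \<subseteq> K <#> L" using subgroup.subset[OF L] by fastforce
qed

context fmr
begin

lemma connected_trivial: "connected_subgroup S G {\<one>}"
  unfolding connected_subgroup_def def_subgroup_def
  by (metis psubset_imp_ex_mem singletonD subgroup.one_closed DiffE)

text \<open>A definable subgroup of finite index in \<open>K <#> L\<close> meets \<open>K\<close> and \<open>L\<close> in subgroups of finite index,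
  so it contains both.\<close>

lemma connected_set_mult:
  assumes K: "def_subgroup S G K" "connected_subgroup S G K"
    and L: "def_subgroup S G L" "connected_subgroup S G L"
  shows "connected_subgroup S G (K <#> L)"
  unfolding connected_subgroup_def
proof
  assume "\<exists>B. def_subgroup S G B \<and> B \<subset> K <#> L \<and> finite (rcosets\<^bsub>G\<lparr>carrier := K <#> L\<rparr>\<^esub> B)"
  then obtain B where B: "def_subgroup S G B" "B \<subset> K <#> L"
    and fin: "finite ((\<lambda>a. B #> a) ` (K <#> L))" unfolding rcosets_restrict by blast
  have *: "M \<subseteq> B" if M: "def_subgroup S G M" "connected_subgroup S G M" "M \<subseteq> K <#> L" for M
  proof (rule ccontr)
    assume "\<not> M \<subseteq> B"
    then have "M \<inter> B \<subset> M" by blast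
    moreover have "finite (rcosets\<^bsub>G\<lparr>carrier := M\<rparr>\<^esub> (M \<inter> B))"
    proof (rule finite_rcosetsI)
      show "finite ((\<lambda>a. B #> a) ` M)" using fin M(3) by (meson finite_subset image_mono)
      fix a b assume ab: "a \<in> M" "b \<in> M" "B #> a = B #> b"
      moreover have "a \<in> carrier G" "b \<in> carrier G" using ab def_subgroup_subset[OF M(1)] by auto
      ultimately show "a \<otimes> inv b \<in> M \<inter> B"
        using rcos_eq_iff[OF def_subgroupD(1)[OF B(1)]] def_subgroupD(1)[OF M(1)]
        by (simp add: subgroup.m_closed subgroup.m_inv_closed)
    qed (use M B def_subgroup_subset def_subgroup_Int def_subgroupD in blast)+
    ultimately show False
      using M(2) def_subgroup_Int[OF M(1) B(1)] by (auto simp: connected_subgroup_def)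
  qed
  have "K \<subseteq> B" "L \<subseteq> B"
    using *[OF K] *[OF L] set_mult_increasing[OF def_subgroupD(1)[OF K(1)] def_subgroupD(1)[OF L(1)]]
    by blast+
  then have "K <#> L \<subseteq> B"
    using def_subgroupD(1)[OF B(1)] subgroup.m_closed unfolding set_mult_def by fastforce
  then show False using B(2) by blast
qed

text \<open>The product of two candidates is again proper, since \<open>A\<close> is indecomposable, and connected.  So a
  maximal candidate contains every other one, which also justifies the definite description in
  \<open>radical\<close>.\<close>

lemma radical_greatest:
  assumes A: "def_subgroup S G A" and comm: "comm_group (G\<lparr>carrier := A\<rparr>)"
    and nontriv: "A \<noteq> {\<one>}" and indec: "indecomposable S G A"
  shows "radical_candidate S G A (radical S G A)"
    and "radical_candidate S G A B \<Longrightarrow> B \<subseteq> radical S G A"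
proof -
  note cand = indecomposable_radical_candidate_iff[OF indec]
  have commA: "a \<otimes> b = b \<otimes> a" if "a \<in> A" "b \<in> A" for a b
    using comm_groupE(4)[OF comm] that by simp
  have "{\<one>} \<subset> A" using nontriv def_subgroupD(1)[OF A] subgroup.one_closed by blast
  then have "radical_candidate S G A {\<one>}"
    using cand def_subgroup_trivial connected_trivial by blast
  then obtain J where J: "radical_candidate S G A J"
    and max: "\<And>B. radical_candidate S G A B \<Longrightarrow> J \<subseteq> B \<Longrightarrow> B = J"
    using ex_maximal_connected_subgroup[of "radical_candidate S G A"] cand by metis
  have le: "B \<subseteq> J" if B: "radical_candidate S G A B" for B
  proof -
    note J' = J[unfolded cand] and B' = B[unfolded cand]
    have def: "def_subgroup S G (J <#> B)"
      using J' B' commA by (intro def_subgroup_set_mult) blast+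
    have sub: "J <#> B \<subseteq> A"
      using J' B' subgroup.m_closed[OF def_subgroupD(1)[OF A]] unfolding set_mult_def by blast
    have "J <#> B \<noteq> A" using indec J' B' unfolding indecomposable_def by blast
    then have "radical_candidate S G A (J <#> B)"
      unfolding cand using def sub J' B' connected_set_mult by blast
    moreover have "J \<subseteq> J <#> B" "B \<subseteq> J <#> B"
      using set_mult_increasing[of J B] J' B' def_subgroupD(1) by blast+
    ultimately show ?thesis using max by blast
  qed
  then have "radical S G A = J" using J by (intro radical_eqI) blast+
  then show "radical_candidate S G A (radical S G A)"
    "radical_candidate S G A B \<Longrightarrow> B \<subseteq> radical S G A"
    using J le by blast+
qed

end

definition U0_generator ::
    "('a, 'r, 'c) induced_structure \<Rightarrow> int \<Rightarrow> ('c, 'm) monoid_scheme \<Rightarrow> 'c set \<Rightarrow> bool" where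
  "U0_generator S r G A \<longleftrightarrow> def_subgroup S G A \<and> comm_group (G\<lparr>carrier := A\<rparr>) \<and>
       A \<noteq> {\<one>\<^bsub>G\<^esub>} \<and> indecomposable S G A \<and> int (reduced_rank S G A) = r \<and>
       torsion_free (G\<lparr>carrier := A\<rparr> Mod radical S G A)"

lemma U0_eq: "U0 S r G = generate G (\<Union>{A. U0_generator S r G A})"
  by (simp add: U0_def U0_generator_def)

context fmr
begin

lemma U0_generator_radical:
  assumes A: "U0_generator S r G A"
  shows "def_subgroup S G (radical S G A)" "radical S G A \<subset> A"
    "connected_subgroup S G (radical S G A)"
    "\<And>a n. a \<in> A \<Longrightarrow> 0 < n \<Longrightarrow> a [^] (n::nat) \<in> radical S G A \<Longrightarrow> a \<in> radical S G A"
proof -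
  note A' = A[unfolded U0_generator_def]
  show J: "def_subgroup S G (radical S G A)" "radical S G A \<subset> A"
    "connected_subgroup S G (radical S G A)"
    using radical_greatest(1)[of A] A' by (auto simp: radical_candidate_def)
  interpret A: comm_group "G\<lparr>carrier := A\<rparr>" using A' by blast
  have "radical S G A \<lhd> G\<lparr>carrier := A\<rparr>"
    using J A' by (intro A.subgroup_imp_normal subgroup_incl) (auto simp: def_subgroupD)
  then show "a \<in> radical S G A" if "a \<in> A" "0 < n" "a [^] (n::nat) \<in> radical S G A" for a n
    using A.torsion_free_Mod_iff A' that by (auto simp: nat_pow_consistent[symmetric])
qed

text \<open>A definable subgroup \<open>K\<close> of \<open>A\<close> has a minimal definable subgroup over which it is
  torsion; such a subgroup is connected, hence inside the radical if \<open>K\<close> is proper.  As \<open>A\<close> has no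
  torsion modulo the radical, \<open>K\<close> itself is inside.\<close>

lemma proper_def_subgroup_le_radical:
  assumes A: "U0_generator S r G A" and K: "def_subgroup S G K" "K \<subset> A"
  shows "K \<subseteq> radical S G A"
proof -
  note A' = A[unfolded U0_generator_def]
  let ?Q = "\<lambda>L. def_subgroup S G L \<and> L \<subseteq> K \<and> (\<forall>k\<in>K. \<exists>n::nat. 0 < n \<and> k [^] n \<in> L)"
  have "?Q K"
    using K def_subgroup_subset[OF K(1)] by (auto intro!: exI[of _ 1])
  then obtain L where L: "?Q L" and min: "\<And>B. ?Q B \<Longrightarrow> B \<subseteq> L \<Longrightarrow> B = L"
    using ex_minimal_def_subgroup[of ?Q K] by blast
  have "connected_subgroup S G L"
    unfolding connected_subgroup_def
  proof
    assume "\<exists>B. def_subgroup S G B \<and> B \<subset> L \<and> finite (rcosets\<^bsub>G\<lparr>carrier := L\<rparr>\<^esub> B)"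
    then obtain B where B: "def_subgroup S G B" "B \<subset> L" "finite ((\<lambda>a. B #> a) ` L)"
      unfolding rcosets_restrict by blast
    have tors: "\<exists>n::nat. 0 < n \<and> l [^] n \<in> B" if l: "l \<in> L" for l
    proof -
      have lc: "l \<in> carrier G" using l L def_subgroup_subset by blast
      have "l [^] (n::nat) \<in> L" for n
        using l L def_subgroupD(1) subgroup.m_closed subgroup.one_closed by (induction n) fastforce+
      then have "finite (range (\<lambda>n::nat. B #> l [^] n))"
        using B(3) by (rule_tac finite_subset[OF _ B(3)]) blast
      then have "\<not> inj (\<lambda>n::nat. B #> l [^] n)" using finite_imageD infinite_UNIV_nat by blast
      then obtain m n :: nat where mn: "m < n" "B #> l [^] n = B #> l [^] m"
        unfolding inj_def by (metis nat_neq_iff)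
      then have "l [^] n \<otimes> inv (l [^] m) \<in> B"
        using rcos_eq_iff[OF def_subgroupD(1)[OF B(1)]] lc by simp
      moreover have "l [^] n = l [^] (n - m) \<otimes> l [^] m"
        using mn(1) lc by (simp add: nat_pow_mult)
      ultimately have "l [^] (n - m) \<in> B" using lc by (simp add: m_assoc)
      then show ?thesis using mn(1) by (intro exI[of _ "n - m"]) simp
    qed
    have "\<exists>n::nat. 0 < n \<and> k [^] n \<in> B" if k: "k \<in> K" for k
    proof -
      obtain n :: nat where n: "0 < n" "k [^] n \<in> L" using L k by blast
      obtain m :: nat where m: "0 < m" "(k [^] n) [^] m \<in> B" using tors n(2) by blast
      have "k \<in> carrier G" using k def_subgroup_subset[OF K(1)] by blast
      then show ?thesis using n m by (intro exI[of _ "n * m"]) (simp add: nat_pow_pow)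
    qed
    then have "B = L" using B L by (intro min) auto
    then show False using B(2) by blast
  qed
  then have "radical_candidate S G A L"
    using indecomposable_radical_candidate_iff A' L K(2) by blast
  then have "L \<subseteq> radical S G A" using radical_greatest(2)[of A] A' by blast
  show ?thesis
  proof
    fix k assume k: "k \<in> K"
    then obtain n :: nat where n: "0 < n" "k [^] n \<in> L" using L by blast
    have "k \<in> A" using k K(2) by blast
    from U0_generator_radical(4)[OF A this n(1)] show "k \<in> radical S G A"
      using n(2) \<open>L \<subseteq> radical S G A\<close> by blast
  qed
qed

end

section \<open>Sections of the group and images of generators\<close>

locale fmr_section = fmr S G
  for S :: "('a, 'r, 'c) induced_structure" and G :: "('c, 'm) monoid_scheme" (structure) +
  fixes N H :: "'c set"
  assumes N: "subgroup N G" and H: "def_subgroup S G H"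
    and H_normal: "H \<lhd> G\<lparr>carrier := N\<rparr>"
begin

abbreviation Q where "Q \<equiv> G\<lparr>carrier := N\<rparr> Mod H"
abbreviation SQ where "SQ \<equiv> quotient_structure S G N H"

sublocale Q: group Q
  using H_normal by (rule normal.factorgroup_is_group)

lemma N_subset: "N \<subseteq> carrier G" and H_subset: "H \<subseteq> N"
  using N H_normal normal_imp_subgroup subgroup.subset by fastforce+

lemma carrier_Q: "carrier Q = (\<lambda>g. H #> g) ` N"
  by (simp add: carrier_FactGroup)

lemma Q_closed: "g \<in> N \<Longrightarrow> H #> g \<in> carrier Q"
  by (simp add: carrier_Q)

lemma Q_mult: "g \<in> N \<Longrightarrow> h \<in> N \<Longrightarrow> (H #> g) \<otimes>\<^bsub>Q\<^esub> (H #> h) = H #> (g \<otimes> h)"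
  using normal.rcos_sum[OF H_normal, of g h] by simp

lemma Q_inv:
  assumes g: "g \<in> N" shows "inv\<^bsub>Q\<^esub> (H #> g) = H #> inv g"
proof (rule Q.inv_equality)
  have "inv g \<in> N" using g by (rule subgroup.m_inv_closed[OF N])
  moreover have "inv g \<otimes> g = \<one>" using g N_subset by auto
  moreover have "H #> \<one> = H" using H_subset N_subset by (intro coset_mult_one) blast
  ultimately show "(H #> inv g) \<otimes>\<^bsub>Q\<^esub> (H #> g) = \<one>\<^bsub>Q\<^esub>" "H #> inv g \<in> carrier Q"
    using g by (simp_all add: Q_mult Q_closed del: mult_FactGroup)
qed (rule Q_closed[OF g])

text \<open>Subsets of the section correspond to unions of cosets of \<open>H\<close> in \<open>N\<close>.\<close>

definition lift :: "'c set set \<Rightarrow> 'c set" where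
  "lift X = {g \<in> N. H #> g \<in> X}"

lemma pres_SQ: "pres SQ x = Some c \<longleftrightarrow> (\<exists>g\<in>N. pres S x = Some g \<and> c = H #> g)"
  by (auto simp: quotient_structure_def split: option.splits)

lemma def_set_SQ_iff: "def_set SQ X \<longleftrightarrow> X \<subseteq> carrier Q \<and> def_set S (lift X)"
proof -
  have "ran (pres SQ) = carrier Q"
  proof
    show "ran (pres SQ) \<subseteq> carrier Q" unfolding carrier_Q ran_def pres_SQ by blast
    show "carrier Q \<subseteq> ran (pres SQ)"
    proof
      fix c assume "c \<in> carrier Q"
      then obtain g where g: "g \<in> N" "c = H #> g" unfolding carrier_Q by blast
      then obtain x where "pres S x = Some g" using pres_surj N_subset by blast
      then have "pres SQ x = Some c" unfolding pres_SQ using g by blast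
      then show "c \<in> ran (pres SQ)" by (rule ranI)
    qed
  qed
  moreover have "pres SQ x \<in> Some ` X \<longleftrightarrow> pres S x \<in> Some ` lift X" for x
    by (auto simp: quotient_structure_def lift_def split: option.splits)
  moreover have "lift X \<subseteq> ran (pres S)" using N_subset by (auto simp: ran_pres lift_def)
  moreover have "base SQ = base S" by (simp add: quotient_structure_def)
  ultimately show ?thesis by (simp add: def_set_def)
qed

end

text \<open>The homomorphism \<open>f\<close> from \<open>A\<close> to the section is given by representatives \<open>\<phi> a\<close> of its values, so
  that definability can be stated in \<open>G\<close>; \<open>\<phi>\<close> need only be multiplicative modulo \<open>H\<close>.\<close>

locale fmr_section_hom = fmr_section S G N H
  for S :: "('a, 'r, 'c) induced_structure" and G :: "('c, 'm) monoid_scheme" (structure)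
    and N H :: "'c set" +
  fixes r :: int and A :: "'c set" and \<phi> :: "'c \<Rightarrow> 'c"
  assumes A: "U0_generator S r G A"
    and \<phi>_definable: "definable_term (\<lambda>e. \<phi> (e 0))"
    and \<phi>_closed: "\<And>a. a \<in> A \<Longrightarrow> \<phi> a \<in> N"
    and \<phi>_mult: "\<And>a b. a \<in> A \<Longrightarrow> b \<in> A \<Longrightarrow> H #> \<phi> (a \<otimes> b) = H #> (\<phi> a \<otimes> \<phi> b)"
    and \<phi>_nontrivial: "\<exists>a\<in>A. \<phi> a \<notin> H"
begin

definition f :: "'c \<Rightarrow> 'c set" where "f a = H #> \<phi> a"

abbreviation J where "J \<equiv> radical S G A"

lemma A_def: "def_subgroup S G A" and A_comm: "comm_group (G\<lparr>carrier := A\<rparr>)"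
  and A_indec: "indecomposable S G A"
  using A by (auto simp: U0_generator_def)

lemmas A_subgroup = def_subgroupD(1)[OF A_def]
lemmas A_closed = subgroup.m_closed[OF A_subgroup] subgroup.m_inv_closed[OF A_subgroup]
  subgroup.one_closed[OF A_subgroup]

lemma A_subset: "A \<subseteq> carrier G"
  by (rule def_subgroup_subset[OF A_def])

lemma f_closed: "a \<in> A \<Longrightarrow> f a \<in> carrier Q"
  by (simp add: f_def Q_closed \<phi>_closed)

lemma f_mult: "a \<in> A \<Longrightarrow> b \<in> A \<Longrightarrow> f (a \<otimes> b) = f a \<otimes>\<^bsub>Q\<^esub> f b"
  unfolding f_def by (simp add: \<phi>_mult Q_mult \<phi>_closed del: mult_FactGroup)

sublocale f: group_hom "G\<lparr>carrier := A\<rparr>" Q f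
proof (rule group_hom.intro)
  show "group (G\<lparr>carrier := A\<rparr>)" by (rule subgroup_imp_group[OF A_subgroup])
  show "group_hom_axioms (G\<lparr>carrier := A\<rparr>) Q f"
    using f_closed f_mult by (auto simp: group_hom_axioms_def hom_def simp del: mult_FactGroup)
qed (rule Q.is_group)

lemma f_one: "f \<one> = \<one>\<^bsub>Q\<^esub>"
  using f.hom_one by simp

lemma f_inv: "a \<in> A \<Longrightarrow> f (inv a) = inv\<^bsub>Q\<^esub> (f a)"
  using f.hom_inv[of a] m_inv_consistent[OF A_subgroup] by simp

lemma f_div: "a \<in> A \<Longrightarrow> b \<in> A \<Longrightarrow> f (a \<otimes> inv b) = f a \<otimes>\<^bsub>Q\<^esub> inv\<^bsub>Q\<^esub> f b"
  using A_closed by (simp add: f_mult f_inv del: mult_FactGroup)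

lemma f_pow: "a \<in> A \<Longrightarrow> f (a [^] n) = f a [^]\<^bsub>Q\<^esub> (n::nat)"
  using f.hom_nat_pow[of a n] by (simp add: nat_pow_consistent[symmetric])

definition pullback :: "'c set set \<Rightarrow> 'c set" where "pullback X = {a \<in> A. f a \<in> X}"

lemma pullback_subset: "pullback X \<subseteq> A"
  by (auto simp: pullback_def)

lemma image_pullback: "X \<subseteq> f ` A \<Longrightarrow> f ` pullback X = X"
  by (auto simp: pullback_def)

lemma pullback_psubset: "X \<subset> f ` A \<Longrightarrow> pullback X \<subset> A"
  using image_pullback[of X] pullback_subset[of X] by blast

lemma def_subgroup_pullback:
  assumes X: "def_subgroup SQ Q X" shows "def_subgroup S G (pullback X)"
  unfolding def_subgroup_def
proof
  have sub: "subgroup X Q" and def: "def_set S (lift X)"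
    using X def_set_SQ_iff by (auto simp: def_subgroup_def)
  show "subgroup (pullback X) G"
    using A_subset A_closed subgroup.m_closed[OF sub] subgroup.m_inv_closed[OF sub]
      subgroup.one_closed[OF sub]
    by (intro subgroupI)
      (auto simp: pullback_def f_mult f_inv f_one intro!: exI[of _ \<one>] simp del: mult_FactGroup one_FactGroup)
  have "def_set S {a \<in> carrier G. a \<in> A \<and> \<phi> a \<in> lift X}"
    using def def_subgroupD(2)[OF A_def]
    by (intro def_set_Collect group_definable_intros \<phi>_definable)
  also have "{a \<in> carrier G. a \<in> A \<and> \<phi> a \<in> lift X} = pullback X"
    using A_subset \<phi>_closed by (auto simp: pullback_def lift_def f_def)
  finally show "def_set S (pullback X)" .
qed

lemma def_subgroup_image:
  assumes K: "def_subgroup S G K" "K \<subseteq> A" shows "def_subgroup SQ Q (f ` K)"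
  unfolding def_subgroup_def def_set_SQ_iff
proof (intro conjI)
  have "subgroup K (G\<lparr>carrier := A\<rparr>)"
    by (rule subgroup_incl[OF def_subgroupD(1)[OF K(1)] A_subgroup K(2)])
  then show sub: "subgroup (f ` K) Q" by (rule f.subgroup_img_is_subgroup)
  show "f ` K \<subseteq> carrier Q" by (rule subgroup.subset[OF sub])
  have "def_set S {g \<in> carrier G. \<exists>k\<in>carrier G. k \<in> K \<and> g \<otimes> inv (\<phi> k) \<in> H}"
    using K H definable_term_reindex[OF \<phi>_definable, of "\<lambda>_. 0"]
    by (intro def_set_Collect group_definable_intros) (auto simp: def_subgroupD)
  also have "{g \<in> carrier G. \<exists>k\<in>carrier G. k \<in> K \<and> g \<otimes> inv (\<phi> k) \<in> H} = lift (f ` K)"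
  proof -
    have *: "g \<otimes> inv (\<phi> k) \<in> H \<longleftrightarrow> g \<in> N \<and> H #> g = f k" if "g \<in> carrier G" "k \<in> K" for g k
    proof -
      have k: "\<phi> k \<in> N" using that K \<phi>_closed by blast
      have "g \<in> N" if "g \<otimes> inv (\<phi> k) \<in> H"
      proof -
        have "g \<otimes> inv (\<phi> k) \<otimes> \<phi> k \<in> N"
          using that k H_subset subgroup.m_closed[OF N] by blast
        then show ?thesis using k \<open>g \<in> carrier G\<close> N_subset by (auto simp: m_assoc)
      qed
      then show ?thesis
        using rcos_eq_iff[OF def_subgroupD(1)[OF H] that(1), of "\<phi> k"] k N_subset
        by (auto simp: f_def)
    qed
    have "g \<in> lift (f ` K) \<longleftrightarrow> g \<in> carrier G \<and> (\<exists>k\<in>carrier G. k \<in> K \<and> g \<otimes> inv (\<phi> k) \<in> H)" for g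
    proof -
      have "g \<in> lift (f ` K) \<longleftrightarrow> g \<in> carrier G \<and> (\<exists>k\<in>K. g \<in> N \<and> H #> g = f k)"
        using N_subset by (auto simp: lift_def)
      also have "\<dots> \<longleftrightarrow> g \<in> carrier G \<and> (\<exists>k\<in>carrier G. k \<in> K \<and> g \<otimes> inv (\<phi> k) \<in> H)"
        using * def_subgroup_subset[OF K(1)] by blast
      finally show ?thesis .
    qed
    then show ?thesis by blast
  qed
  finally show "def_set S (lift (f ` K))" .
qed

text \<open>The kernel is a proper definable subgroup of \<open>A\<close>.\<close>

lemma kernel_subset: "a \<in> A \<Longrightarrow> f a = \<one>\<^bsub>Q\<^esub> \<Longrightarrow> a \<in> J"
proof -
  have "def_subgroup SQ Q {\<one>\<^bsub>Q\<^esub>}"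
    using def_subgroup_image[OF def_subgroup_trivial] A_closed f_one by simp
  then have "def_subgroup S G (pullback {\<one>\<^bsub>Q\<^esub>})" by (rule def_subgroup_pullback)
  moreover have "pullback {\<one>\<^bsub>Q\<^esub>} \<noteq> A"
  proof -
    obtain a where a: "a \<in> A" "\<phi> a \<notin> H" using \<phi>_nontrivial by blast
    then have "f a \<noteq> H"
      unfolding f_def using coset_join1[OF _ _ def_subgroupD(1)[OF H]] \<phi>_closed N_subset by blast
    then show ?thesis using a by (auto simp: pullback_def)
  qed
  ultimately have "pullback {\<one>\<^bsub>Q\<^esub>} \<subseteq> J"
    using proper_def_subgroup_le_radical[OF A] pullback_subset by blast
  then show "a \<in> A \<Longrightarrow> f a = \<one>\<^bsub>Q\<^esub> \<Longrightarrow> a \<in> J" by (auto simp: pullback_def)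
qed

lemmas J_def = U0_generator_radical(1)[OF A] and J_psubset = U0_generator_radical(2)[OF A]

lemma pullback_image_radical: "pullback (f ` J) = J"
proof
  show "J \<subseteq> pullback (f ` J)" using J_psubset by (auto simp: pullback_def)
  show "pullback (f ` J) \<subseteq> J"
  proof
    fix a assume "a \<in> pullback (f ` J)"
    then obtain j where a: "a \<in> A" and j: "j \<in> J" "f a = f j" by (auto simp: pullback_def)
    have "j \<in> A" using j J_psubset by blast
    then have "f (a \<otimes> inv j) = \<one>\<^bsub>Q\<^esub>" using a j f_closed by (simp add: f_div del: mult_FactGroup one_FactGroup)
    then have "a \<otimes> inv j \<in> J" using a \<open>j \<in> A\<close> A_closed kernel_subset by blast
    then have "a \<otimes> inv j \<otimes> j \<in> J" using j subgroup.m_closed[OF def_subgroupD(1)[OF J_def]] by blast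
    moreover have "a \<in> carrier G" "j \<in> carrier G" using a \<open>j \<in> A\<close> A_subset by auto
    ultimately show "a \<in> J" by (simp add: m_assoc)
  qed
qed

text \<open>The pullback of a subgroup of finite index in the image of \<open>J\<close> has finite index in \<open>J\<close>.\<close>

lemma connected_image_radical: "connected_subgroup SQ Q (f ` J)"
  unfolding connected_subgroup_def
proof
  assume "\<exists>C. def_subgroup SQ Q C \<and> C \<subset> f ` J \<and> finite (rcosets\<^bsub>Q\<lparr>carrier := f ` J\<rparr>\<^esub> C)"
  then obtain C where C: "def_subgroup SQ Q C" "C \<subset> f ` J"
    and fin: "finite ((\<lambda>x. C #>\<^bsub>Q\<^esub> x) ` f ` J)" unfolding rcosets_restrict by blast
  have Csub: "subgroup C Q" using C by (simp add: def_subgroup_def)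
  note def = def_subgroup_pullback[OF C(1)]
  have "C \<subseteq> f ` A" using C J_psubset by blast
  then have "f ` pullback C = C" by (rule image_pullback)
  moreover have "pullback C \<subseteq> J"
    using C(2) pullback_image_radical unfolding pullback_def by blast
  ultimately have "pullback C \<subset> J" using C(2) by blast
  moreover have "finite (rcosets\<^bsub>G\<lparr>carrier := J\<rparr>\<^esub> (pullback C))"
  proof (rule finite_rcosetsI[OF def_subgroupD(1)[OF def] def_subgroup_subset[OF J_def]])
    show "finite ((\<lambda>a. C #>\<^bsub>Q\<^esub> f a) ` J)" using fin by (simp add: image_image)
    fix a b assume ab: "a \<in> J" "b \<in> J" "C #>\<^bsub>Q\<^esub> f a = C #>\<^bsub>Q\<^esub> f b"
    then have abA: "a \<in> A" "b \<in> A" using J_psubset by auto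
    then have "f (a \<otimes> inv b) \<in> C"
      using Q.rcos_eq_iff[OF Csub f_closed f_closed] ab(3) f_div by metis
    then show "a \<otimes> inv b \<in> pullback C" using abA A_closed by (simp add: pullback_def)
  qed
  ultimately show False
    using U0_generator_radical(3)[OF A] def unfolding connected_subgroup_def by blast
qed

text \<open>A decomposition of the image pulls back to one of \<open>A\<close>.\<close>

lemma indecomposable_image: "indecomposable SQ Q (f ` A)"
  unfolding indecomposable_def
proof
  assume "\<exists>B1 B2. def_subgroup SQ Q B1 \<and> def_subgroup SQ Q B2 \<and> B1 \<subset> f ` A \<and> B2 \<subset> f ` A \<and>
      B1 <#>\<^bsub>Q\<^esub> B2 = f ` A"
  then obtain B1 B2 where B: "def_subgroup SQ Q B1" "def_subgroup SQ Q B2" "B1 \<subset> f ` A" "B2 \<subset> f ` A"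
    and eq: "B1 <#>\<^bsub>Q\<^esub> B2 = f ` A" by (elim exE conjE) (rule that)
  have "a \<in> pullback B1 <#> pullback B2" if a: "a \<in> A" for a
  proof -
    have "f a \<in> B1 <#>\<^bsub>Q\<^esub> B2" using eq a by blast
    then obtain b1 b2 where b: "b1 \<in> B1" "b2 \<in> B2" "f a = b1 \<otimes>\<^bsub>Q\<^esub> b2"
      unfolding set_mult_def by blast
    obtain a2 where a2: "a2 \<in> A" "b2 = f a2" using b B by blast
    have "b1 \<in> carrier Q" using b(1) B(3) f_closed by blast
    then have "f (a \<otimes> inv a2) = b1"
      using b a a2 f_closed by (simp add: f_div Q.m_assoc del: mult_FactGroup one_FactGroup)
    then have "a \<otimes> inv a2 \<in> pullback B1" "a2 \<in> pullback B2"
      using a a2 b A_closed by (auto simp: pullback_def)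
    moreover have "a \<in> carrier G" "a2 \<in> carrier G" using a a2 A_subset by auto
    then have "a = a \<otimes> inv a2 \<otimes> a2" by (simp add: m_assoc)
    ultimately show ?thesis unfolding set_mult_def by blast
  qed
  moreover have "pullback B1 <#> pullback B2 \<subseteq> A"
    using pullback_subset A_closed(1) unfolding set_mult_def by blast
  ultimately have "pullback B1 <#> pullback B2 = A" by blast
  then show False
    using A_indec def_subgroup_pullback[OF B(1)] def_subgroup_pullback[OF B(2)]
      pullback_psubset[OF B(3)] pullback_psubset[OF B(4)]
    unfolding indecomposable_def by blast
qed

text \<open>Proper definable subgroups of the image pull back to proper definable subgroups of \<open>A\<close>, all
  of which lie in \<open>J\<close>.\<close>

lemma radical_image: "radical SQ Q (f ` A) = f ` J"
proof (rule radical_eqI)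
  have "f ` J \<subset> f ` A"
  proof
    show "f ` J \<subseteq> f ` A" using J_psubset by (intro image_mono) blast
    have "pullback (f ` A) = A" by (auto simp: pullback_def)
    then show "f ` J \<noteq> f ` A" using pullback_image_radical J_psubset by auto
  qed
  then show "radical_candidate SQ Q (f ` A) (f ` J)"
    using indecomposable_radical_candidate_iff[OF indecomposable_image]
      def_subgroup_image[OF J_def] connected_image_radical J_psubset by blast
next
  fix X assume "radical_candidate SQ Q (f ` A) X"
  then have X: "def_subgroup SQ Q X" "X \<subset> f ` A"
    by (auto simp: radical_candidate_def)
  then have "pullback X \<subseteq> J"
    by (intro proper_def_subgroup_le_radical[OF A] def_subgroup_pullback pullback_psubset)
  then have "f ` pullback X \<subseteq> f ` J" by (rule image_mono)
  then show "X \<subseteq> f ` J" using image_pullback[OF psubset_imp_subset[OF X(2)]] by simp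
qed

lemma comm_group_image: "comm_group (Q\<lparr>carrier := f ` A\<rparr>)"
proof -
  have sub: "subgroup (f ` A) Q"
    using def_subgroup_image[OF A_def] by (simp add: def_subgroup_def)
  show ?thesis
  proof (rule group.group_comm_groupI[OF Q.subgroup_imp_group[OF sub]])
    fix x y assume "x \<in> carrier (Q\<lparr>carrier := f ` A\<rparr>)" "y \<in> carrier (Q\<lparr>carrier := f ` A\<rparr>)"
    then obtain a b where ab: "a \<in> A" "b \<in> A" "x = f a" "y = f b" by auto
    have "a \<otimes> b = b \<otimes> a" using comm_groupE(4)[OF A_comm] ab by simp
    then show "x \<otimes>\<^bsub>Q\<lparr>carrier := f ` A\<rparr>\<^esub> y = y \<otimes>\<^bsub>Q\<lparr>carrier := f ` A\<rparr>\<^esub> x"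
      using ab f_mult by (metis monoid.simps(1) monoid.surjective partial_object.update_convs(1))
  qed
qed

lemma torsion_free_image: "torsion_free (Q\<lparr>carrier := f ` A\<rparr> Mod f ` J)"
proof -
  interpret B: comm_group "Q\<lparr>carrier := f ` A\<rparr>" by (rule comm_group_image)
  have "f ` J \<lhd> Q\<lparr>carrier := f ` A\<rparr>"
    using def_subgroup_image[OF J_def] def_subgroup_image[OF A_def] J_psubset
    by (intro B.subgroup_imp_normal Q.subgroup_incl) (auto simp: def_subgroup_def)
  moreover have "f a \<in> f ` J" if "a \<in> A" "0 < n" "f a [^]\<^bsub>Q\<^esub> (n::nat) \<in> f ` J" for a n
  proof -
    have "a [^] n \<in> A" using that(1) A_closed by (induction n) auto
    then have "a [^] n \<in> pullback (f ` J)" using that f_pow by (simp add: pullback_def)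
    then show ?thesis
      using U0_generator_radical(4)[OF A that(1,2)] pullback_image_radical by blast
  qed
  ultimately show ?thesis
    by (subst B.torsion_free_Mod_iff) (auto simp: Q.nat_pow_consistent[symmetric])
qed

end

lemma pres_quotient_structure:
  "pres (quotient_structure S G A K) x = Some c \<longleftrightarrow> (\<exists>g\<in>A. pres S x = Some g \<and> c = K #>\<^bsub>G\<^esub> g)"
  by (auto simp: quotient_structure_def split: option.splits)

context fmr_section_hom
begin

abbreviation B where "B \<equiv> f ` A"
abbreviation TA where "TA \<equiv> quotient_structure S G A J"
abbreviation TB where "TB \<equiv> quotient_structure SQ Q B (f ` J)"

text \<open>The cosets modulo the radicals of elements of \<open>A\<close> and of \<open>lift B\<close>, both taken in the
  quotient of \<open>B\<close> by its radical.\<close>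

definition coset_of_A where "coset_of_A g = f ` J #>\<^bsub>Q\<^esub> f g"
definition coset_of_B where "coset_of_B h = f ` J #>\<^bsub>Q\<^esub> (H #> h)"

lemma image_radical_subgroup: "subgroup (f ` J) Q" and def_set_lift_radical: "def_set S (lift (f ` J))"
  and def_set_lift_B: "def_set S (lift B)"
  using def_subgroup_image[OF J_def] def_subgroup_image[OF A_def] J_psubset
  by (auto simp: def_subgroup_def def_set_SQ_iff)

lemma coset_of_A_eq_iff:
  assumes "g \<in> A" "g' \<in> A" shows "coset_of_A g = coset_of_A g' \<longleftrightarrow> J #> g = J #> g'"
proof -
  have "coset_of_A g = coset_of_A g' \<longleftrightarrow> f (g \<otimes> inv g') \<in> f ` J"
    unfolding coset_of_A_def using Q.rcos_eq_iff[OF image_radical_subgroup] assms f_closed f_div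
    by metis
  also have "\<dots> \<longleftrightarrow> g \<otimes> inv g' \<in> pullback (f ` J)"
    using assms A_closed by (simp add: pullback_def)
  also have "\<dots> \<longleftrightarrow> J #> g = J #> g'"
    unfolding pullback_image_radical
    using rcos_eq_iff[OF def_subgroupD(1)[OF J_def]] assms A_subset by blast
  finally show ?thesis .
qed

lemma coset_of_B_eq_iff:
  assumes "h \<in> N" "h' \<in> N"
  shows "f ` J #>\<^bsub>Q\<^esub> (H #> h) = f ` J #>\<^bsub>Q\<^esub> (H #> h') \<longleftrightarrow> h \<otimes> inv h' \<in> lift (f ` J)"
proof -
  have inv: "inv h' \<in> N" and closed: "h \<otimes> inv h' \<in> N"
    using assms subgroup.m_inv_closed[OF N] subgroup.m_closed[OF N] by auto
  have "(H #> h) \<otimes>\<^bsub>Q\<^esub> inv\<^bsub>Q\<^esub> (H #> h') = H #> (h \<otimes> inv h')"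
    using assms inv by (simp add: Q_inv Q_mult del: mult_FactGroup)
  then show ?thesis
    using Q.rcos_eq_iff[OF image_radical_subgroup Q_closed Q_closed] assms closed
    by (simp add: lift_def del: mult_FactGroup)
qed

lemma pres_TA: "pres TA x = Some c \<longleftrightarrow> (\<exists>g\<in>A. pres S x = Some g \<and> c = J #> g)"
  by (rule pres_quotient_structure)

lemma pres_TB:
  "pres TB y = Some d \<longleftrightarrow> (\<exists>h\<in>lift B. pres S y = Some h \<and> d = coset_of_B h)"
proof -
  have "(\<exists>c\<in>X. (\<exists>h\<in>N. P h \<and> c = u h) \<and> d = v c) \<longleftrightarrow> (\<exists>h\<in>{h \<in> N. u h \<in> X}. P h \<and> d = v (u h))"
    for X :: "'c set set" and P u and v :: "_ \<Rightarrow> 'c set set" by auto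
  then show ?thesis unfolding pres_quotient_structure[of SQ] pres_SQ coset_of_B_def lift_def .
qed

lemma dom_TA: "x \<in> dom (pres TA) \<longleftrightarrow> (\<exists>g\<in>A. pres S x = Some g)"
  and dom_TB: "y \<in> dom (pres TB) \<longleftrightarrow> (\<exists>h\<in>lift B. pres S y = Some h)"
  by (simp_all only: domIff not_None_eq pres_TA pres_TB) metis+

text \<open>The relation between presentations that is induced by the isomorphism from \<open>A\<close> modulo \<open>J\<close> to
  \<open>B\<close> modulo its radical.\<close>

definition graph :: "'a \<Rightarrow> 'a \<Rightarrow> bool" where
  "graph x y \<longleftrightarrow> (\<exists>g h. pres S x = Some g \<and> pres S y = Some h \<and>
     g \<in> A \<and> h \<in> lift B \<and> coset_of_B h = coset_of_A g)"

lemma coset_condition_iff: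
  assumes "g \<in> A" "h \<in> lift B"
  shows "coset_of_B h = coset_of_A g \<longleftrightarrow> h \<otimes> inv (\<phi> g) \<in> lift (f ` J)"
  using coset_of_B_eq_iff[of h "\<phi> g"] \<phi>_closed[OF assms(1)] assms(2)
  by (simp add: coset_of_A_def coset_of_B_def f_def lift_def)

lemma graph_iff:
  "graph x y \<longleftrightarrow> (\<exists>g h. pres S x = Some g \<and> pres S y = Some h \<and>
     g \<in> A \<and> h \<in> lift B \<and> h \<otimes> inv (\<phi> g) \<in> lift (f ` J))"
  unfolding graph_def using coset_condition_iff by (auto intro!: ex_cong1)

lemma definable_graph:
  "definable (base S) 2 {[x, y] | x y. graph x y}"
  "definable (base S) 2 {[y, x] | x y. graph x y}"
proof -
  note defs = def_subgroupD(2)[OF A_def] def_set_lift_B def_set_lift_radical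
  have "definable (base S) 2 {[x, y] | x y. \<exists>g h. pres S x = Some g \<and> pres S y = Some h \<and>
      (g \<in> A \<and> h \<in> lift B \<and> h \<otimes> inv (\<phi> g) \<in> lift (f ` J))}"
    by (intro definable2_Collect group_definable_intros defs \<phi>_definable)
  then show "definable (base S) 2 {[x, y] | x y. graph x y}"
    by (simp add: graph_iff)
  have "definable (base S) 2 {[y, x] | y x. \<exists>h g. pres S y = Some h \<and> pres S x = Some g \<and>
      (g \<in> A \<and> h \<in> lift B \<and> h \<otimes> inv (\<phi> g) \<in> lift (f ` J))}"
    using definable_term_reindex[OF \<phi>_definable, of "\<lambda>_. 1"]
    by (intro definable2_Collect group_definable_intros defs)
  also have "{[y, x] | y x. \<exists>h g. pres S y = Some h \<and> pres S x = Some g \<and>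
      (g \<in> A \<and> h \<in> lift B \<and> h \<otimes> inv (\<phi> g) \<in> lift (f ` J))} = {[y, x] | x y. graph x y}"
    unfolding graph_iff by blast
  finally show "definable (base S) 2 {[y, x] | x y. graph x y}" .
qed

lemma definable_kernels:
  "definable (base S) 2 (pres_kernel TA)" "definable (base S) 2 (pres_kernel TB)"
proof -
  note defs = def_subgroupD(2)[OF A_def] def_set_lift_B def_set_lift_radical def_subgroupD(2)[OF J_def]
  have "definable (base S) 2 {[x, y] | x y. \<exists>g h. pres S x = Some g \<and> pres S y = Some h \<and>
      (g \<in> A \<and> h \<in> A \<and> g \<otimes> inv h \<in> J)}"
    by (intro definable2_Collect group_definable_intros defs)
  also have "{[x, y] | x y. \<exists>g h. pres S x = Some g \<and> pres S y = Some h \<and>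
      (g \<in> A \<and> h \<in> A \<and> g \<otimes> inv h \<in> J)} = pres_kernel TA"
  proof -
    have "(\<exists>g h. pres S x = Some g \<and> pres S y = Some h \<and> (g \<in> A \<and> h \<in> A \<and> g \<otimes> inv h \<in> J)) \<longleftrightarrow>
        pres TA x \<noteq> None \<and> pres TA x = pres TA y" for x y
    proof -
      have "pres TA x \<noteq> None \<and> pres TA x = pres TA y \<longleftrightarrow>
          (\<exists>c. pres TA x = Some c \<and> pres TA y = Some c)" by auto
      also have "\<dots> \<longleftrightarrow> (\<exists>g\<in>A. \<exists>h\<in>A. pres S x = Some g \<and> pres S y = Some h \<and> J #> g = J #> h)"
        unfolding pres_TA by blast
      also have "\<dots> \<longleftrightarrow> (\<exists>g\<in>A. \<exists>h\<in>A. pres S x = Some g \<and> pres S y = Some h \<and> g \<otimes> inv h \<in> J)"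
        using rcos_eq_iff[OF def_subgroupD(1)[OF J_def]] A_subset by (intro bex_cong refl) auto
      finally show ?thesis by blast
    qed
    then show ?thesis by (simp add: pres_kernel_def)
  qed
  finally show "definable (base S) 2 (pres_kernel TA)" .
  have "definable (base S) 2 {[x, y] | x y. \<exists>g h. pres S x = Some g \<and> pres S y = Some h \<and>
      (g \<in> lift B \<and> h \<in> lift B \<and> g \<otimes> inv h \<in> lift (f ` J))}"
    by (intro definable2_Collect group_definable_intros defs)
  also have "{[x, y] | x y. \<exists>g h. pres S x = Some g \<and> pres S y = Some h \<and>
      (g \<in> lift B \<and> h \<in> lift B \<and> g \<otimes> inv h \<in> lift (f ` J))} = pres_kernel TB"
  proof -
    have "(\<exists>g h. pres S x = Some g \<and> pres S y = Some h \<and>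
          (g \<in> lift B \<and> h \<in> lift B \<and> g \<otimes> inv h \<in> lift (f ` J))) \<longleftrightarrow>
        pres TB x \<noteq> None \<and> pres TB x = pres TB y" for x y
    proof -
      have "pres TB x \<noteq> None \<and> pres TB x = pres TB y \<longleftrightarrow>
          (\<exists>c. pres TB x = Some c \<and> pres TB y = Some c)" by auto
      also have "\<dots> \<longleftrightarrow> (\<exists>g\<in>lift B. \<exists>h\<in>lift B. pres S x = Some g \<and> pres S y = Some h \<and>
          coset_of_B g = coset_of_B h)"
        unfolding pres_TB by blast
      also have "\<dots> \<longleftrightarrow> (\<exists>g\<in>lift B. \<exists>h\<in>lift B. pres S x = Some g \<and> pres S y = Some h \<and>
          g \<otimes> inv h \<in> lift (f ` J))"
        unfolding coset_of_B_def using coset_of_B_eq_iff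
        by (intro bex_cong refl) (auto simp: lift_def)
      finally show ?thesis by blast
    qed
    then show ?thesis by (simp add: pres_kernel_def)
  qed
  finally show "definable (base S) 2 (pres_kernel TB)" .
qed

lemma definable_domains:
  "definable (base S) 1 {[x] | x. x \<in> dom (pres TA)}"
  "definable (base S) 1 {[x] | x. x \<in> dom (pres TB)}"
proof -
  have "x \<in> dom (pres TA) \<longleftrightarrow> pres S x \<in> Some ` A" for x unfolding dom_TA by blast
  then show "definable (base S) 1 {[x] | x. x \<in> dom (pres TA)}"
    using def_subgroupD(2)[OF A_def] by (simp add: def_set_def)
  have "x \<in> dom (pres TB) \<longleftrightarrow> pres S x \<in> Some ` lift B" for x unfolding dom_TB by blast
  then show "definable (base S) 1 {[x] | x. x \<in> dom (pres TB)}"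
    using def_set_lift_B by (simp add: def_set_def)
qed

lemma graphE:
  assumes "graph x y"
  obtains g h where "pres S x = Some g" "pres S y = Some h" "g \<in> A" "h \<in> lift B"
    "coset_of_B h = coset_of_A g" "pres TA x = Some (J #> g)" "pres TB y = Some (coset_of_B h)"
  using assms unfolding graph_def pres_TA pres_TB by blast

lemma graphI:
  assumes "pres S x = Some g" "pres S y = Some h" "g \<in> A" "h \<in> lift B" "coset_of_B h = coset_of_A g"
  shows "graph x y"
  using assms unfolding graph_def by blast

lemma rank_ge_quotient_eq: "rank_ge TA n \<longleftrightarrow> rank_ge TB n"
proof -
  have TA: "base TA = base S" "ext TA = ext S" by (simp_all add: quotient_structure_def)
  show ?thesis
  proof (rule rank_ge_eq_of_definable_bijection[where S = TA and r = graph, unfolded TA, OF elementary _ _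
        definable_graph definable_kernels definable_domains])
    show "base TB = base S" "ext TB = ext S" by (simp_all add: quotient_structure_def)
  next
    fix x y assume "graph x y"
    then show "x \<in> dom (pres TA) \<and> y \<in> dom (pres TB)" by (rule graphE) auto
  next
    fix x assume "x \<in> dom (pres TA)"
    then obtain g where g: "g \<in> A" "pres S x = Some g" unfolding dom_TA by blast
    obtain y where "pres S y = Some (\<phi> g)" using pres_surj \<phi>_closed[OF g(1)] N_subset by blast
    moreover have "\<phi> g \<in> lift B" using g(1) \<phi>_closed by (auto simp: lift_def f_def)
    moreover have "coset_of_B (\<phi> g) = coset_of_A g" by (simp add: coset_of_A_def coset_of_B_def f_def)
    ultimately show "\<exists>y. graph x y" using g graphI by blast
  next
    fix y assume "y \<in> dom (pres TB)"
    then obtain h where h: "h \<in> lift B" "pres S y = Some h" unfolding dom_TB by blast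
    then obtain g where g: "g \<in> A" "H #> h = f g" by (auto simp: lift_def)
    obtain x where "pres S x = Some g" using pres_surj g(1) A_subset by blast
    moreover have "coset_of_B h = coset_of_A g" using g by (simp add: coset_of_A_def coset_of_B_def)
    ultimately show "\<exists>x. graph x y" using g h graphI by blast
  next
    fix x x' y assume "graph x y" "graph x' y"
    then show "pres TA x = pres TA x'"
      by (elim graphE) (simp add: coset_of_A_eq_iff[symmetric])
  next
    fix x y y' assume "graph x y" "graph x y'"
    then show "pres TB y = pres TB y'" by (elim graphE) simp
  next
    fix x x' y assume xy: "graph x y" and eq: "pres TA x = pres TA x'"
    obtain g h where g: "pres S x = Some g" "pres S y = Some h" "g \<in> A" "h \<in> lift B"
      "coset_of_B h = coset_of_A g" "pres TA x = Some (J #> g)"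
      using xy by (rule graphE)
    then have "pres TA x' = Some (J #> g)" using eq by simp
    then obtain g' where g': "g' \<in> A" "pres S x' = Some g'" "J #> g = J #> g'"
      unfolding pres_TA by blast
    then have "coset_of_A g = coset_of_A g'" using g coset_of_A_eq_iff by blast
    then show "graph x' y" using g g' by (intro graphI) auto
  next
    fix x y y' assume xy: "graph x y" and eq: "pres TB y = pres TB y'"
    obtain g h where g: "pres S x = Some g" "pres S y = Some h" "g \<in> A" "h \<in> lift B"
      "coset_of_B h = coset_of_A g" "pres TB y = Some (coset_of_B h)"
      using xy by (rule graphE)
    then have "pres TB y' = Some (coset_of_B h)" using eq by simp
    then obtain h' where "h' \<in> lift B" "pres S y' = Some h'" "coset_of_B h = coset_of_B h'"
      unfolding pres_TB by blast
    then show "graph x y'" using g by (intro graphI) auto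
  qed
qed

text \<open>The quotients of \<open>A\<close> and of its image by their radicals are definably isomorphic through \<open>f\<close>, so
  they have the same rank; the trivial image is excluded because the kernel lies in \<open>J \<subset> A\<close>.\<close>

theorem U0_generator_image: "U0_generator SQ r Q (f ` A)"
  unfolding U0_generator_def radical_image
proof (intro conjI)
  show "def_subgroup SQ Q (f ` A)" by (rule def_subgroup_image[OF A_def order_refl])
  show "f ` A \<noteq> {\<one>\<^bsub>Q\<^esub>}"
  proof
    assume *: "f ` A = {\<one>\<^bsub>Q\<^esub>}"
    have "a \<in> J" if "a \<in> A" for a
    proof (rule kernel_subset[OF that])
      show "f a = \<one>\<^bsub>Q\<^esub>" using * that by blast
    qed
    then show False using J_psubset by blast
  qed
  have "morley_rank TB = morley_rank TA"
    by (simp add: morley_rank_def rank_ge_quotient_eq)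
  then show "int (reduced_rank SQ Q (f ` A)) = r"
    using A by (simp add: reduced_rank_def radical_image U0_generator_def)
qed (fact comm_group_image indecomposable_image torsion_free_image)+

end

section \<open>Iterated commutators\<close>

context group
begin

definition commutator :: "'a \<Rightarrow> 'a \<Rightarrow> 'a" where
  "commutator x y = x \<otimes> y \<otimes> inv x \<otimes> inv y"

lemma commutator_closed [simp]:
  "x \<in> carrier G \<Longrightarrow> y \<in> carrier G \<Longrightarrow> commutator x y \<in> carrier G"
  by (simp add: commutator_def)

lemma cancel_inv_left [simp]:
  assumes "x \<in> carrier G" "z \<in> carrier G"
  shows "inv x \<otimes> (x \<otimes> z) = z" "x \<otimes> (inv x \<otimes> z) = z"
  using assms by (simp_all add: m_assoc[symmetric])

lemma commutator_inv:
  "x \<in> carrier G \<Longrightarrow> y \<in> carrier G \<Longrightarrow> commutator x y = inv commutator y x"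
  by (simp add: commutator_def inv_mult_group m_assoc)

lemma commutator_conj:
  assumes "x \<in> carrier G" "y \<in> carrier G" "g \<in> carrier G"
  shows "g \<otimes> commutator x y \<otimes> inv g = commutator (g \<otimes> x \<otimes> inv g) (g \<otimes> y \<otimes> inv g)"
  using assms by (simp add: commutator_def inv_mult_group m_assoc)

text \<open>Modulo terms of the lower central series two steps further down, the first factor vanishes; the
  identity then says that the commutator is multiplicative in its first argument.\<close>

lemma commutator_mult:
  assumes "x \<in> carrier G" "x' \<in> carrier G" "y \<in> carrier G"
  shows "commutator (x \<otimes> x') y =
    commutator x (commutator x' y) \<otimes> (commutator x' y \<otimes> commutator x y)"
  using assms by (simp add: commutator_def inv_mult_group m_assoc)

lemma lower_central_Suc:
  "lower_central G (Suc n) = generate G {commutator x y | x y. x \<in> lower_central G n \<and> y \<in> carrier G}"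
  by (simp add: commutator_def)

declare lower_central.simps(2) [simp del]

lemma lower_central_normal: "lower_central G n \<lhd> G"
proof (induction n)
  case 0
  show ?case using subgroup_self by (intro normal_invI) auto
next
  case (Suc n)
  have sub: "lower_central G n \<subseteq> carrier G" using Suc by (intro subgroup.subset normal_imp_subgroup)
  show ?case
    unfolding lower_central_Suc
  proof (rule normal_generateI)
    show "{commutator x y | x y. x \<in> lower_central G n \<and> y \<in> carrier G} \<subseteq> carrier G"
      using sub by auto
    fix h g assume h: "h \<in> {commutator x y | x y. x \<in> lower_central G n \<and> y \<in> carrier G}"
      and g: "g \<in> carrier G"
    then obtain x y where xy: "x \<in> lower_central G n" "y \<in> carrier G" "h = commutator x y" by blast
    then have "g \<otimes> h \<otimes> inv g = commutator (g \<otimes> x \<otimes> inv g) (g \<otimes> y \<otimes> inv g)"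
      using sub g commutator_conj by auto
    moreover have "g \<otimes> x \<otimes> inv g \<in> lower_central G n"
      using normal_invE(2)[OF Suc g xy(1)] .
    ultimately show "g \<otimes> h \<otimes> inv g \<in> {commutator x y | x y. x \<in> lower_central G n \<and> y \<in> carrier G}"
      using xy g by blast
  qed
qed

lemmas lower_central_subgroup = normal_imp_subgroup[OF lower_central_normal]

lemma lower_central_subset: "lower_central G n \<subseteq> carrier G"
  by (rule subgroup.subset[OF lower_central_subgroup])

lemma commutator_lower_central:
  "x \<in> lower_central G n \<Longrightarrow> y \<in> carrier G \<Longrightarrow> commutator x y \<in> lower_central G (Suc n)"
  unfolding lower_central_Suc by (rule generate.incl) blast

lemma commutator_lower_central_right:
  assumes "x \<in> carrier G" "y \<in> lower_central G n" shows "commutator x y \<in> lower_central G (Suc n)"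
  using commutator_lower_central[OF assms(2,1)] subgroup.m_inv_closed[OF lower_central_subgroup]
    commutator_inv[OF assms(1)] assms(2) lower_central_subset by (metis subsetD)

lemma lower_central_antimono: "lower_central G (Suc n) \<subseteq> lower_central G n"
  unfolding lower_central_Suc
proof (rule generate_subgroup_incl[OF _ lower_central_subgroup])
  show "{commutator x y | x y. x \<in> lower_central G n \<and> y \<in> carrier G} \<subseteq> lower_central G n"
  proof
    fix h assume "h \<in> {commutator x y | x y. x \<in> lower_central G n \<and> y \<in> carrier G}"
    then obtain x y where xy: "x \<in> lower_central G n" "y \<in> carrier G" "h = commutator x y" by blast
    have "y \<otimes> inv x \<otimes> inv y \<in> lower_central G n"
      using normal_invE(2)[OF lower_central_normal xy(2)]
        subgroup.m_inv_closed[OF lower_central_subgroup xy(1)] by blast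
    then have "x \<otimes> (y \<otimes> inv x \<otimes> inv y) \<in> lower_central G n"
      using subgroup.m_closed[OF lower_central_subgroup xy(1)] by blast
    moreover have "x \<in> carrier G" using xy lower_central_subset by blast
    ultimately show "h \<in> lower_central G n"
      using xy by (simp add: commutator_def m_assoc)
  qed
qed

lemma iterated_commutator_mem:
  "x \<in> lower_central G i \<Longrightarrow> set ys \<subseteq> carrier G \<Longrightarrow>
     foldl commutator x ys \<in> lower_central G (i + length ys)"
proof (induction ys arbitrary: x i)
  case (Cons y ys)
  have "commutator x y \<in> lower_central G (Suc i)"
    using Cons.prems by (intro commutator_lower_central) auto
  from Cons.IH[OF this] show ?case using Cons.prems by simp
qed simp

text \<open>Iterate \<open>commutator_mult\<close>: the factor two steps down ends up in \<open>L\<^bsub>i+length ys+1\<^esub>\<close>, and the other two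
  commute modulo this term.\<close>

lemma iterated_commutator_mult:
  "x \<in> lower_central G i \<Longrightarrow> x' \<in> lower_central G i \<Longrightarrow> set ys \<subseteq> carrier G \<Longrightarrow>
     lower_central G (Suc (i + length ys)) #> foldl commutator (x \<otimes> x') ys =
     lower_central G (Suc (i + length ys)) #> (foldl commutator x ys \<otimes> foldl commutator x' ys)"
proof (induction ys arbitrary: x x' i)
  case (Cons y ys)
  let ?T = "lower_central G (Suc (Suc i + length ys))" and ?F = "\<lambda>x. foldl commutator x ys"
  define u v w where "u = commutator x (commutator x' y)" and "v = commutator x' y"
    and "w = commutator x y"
  have y: "y \<in> carrier G" and ys: "set ys \<subseteq> carrier G" using Cons.prems by auto
  have x: "x \<in> carrier G" "x' \<in> carrier G" using Cons.prems lower_central_subset by auto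
  have vw: "v \<in> lower_central G (Suc i)" "w \<in> lower_central G (Suc i)"
    unfolding v_def w_def using Cons.prems y by (auto intro: commutator_lower_central)
  then have u: "u \<in> lower_central G (Suc (Suc i))"
    unfolding u_def v_def[symmetric] using x by (intro commutator_lower_central_right)
  have F: "?F v \<in> lower_central G (Suc i + length ys)" "?F w \<in> lower_central G (Suc i + length ys)"
    "?F u \<in> ?T" "?F (v \<otimes> w) \<in> lower_central G (Suc i + length ys)"
    using iterated_commutator_mem[OF _ ys] vw u subgroup.m_closed[OF lower_central_subgroup vw]
    by fastforce+
  note Fc = F[THEN subsetD[OF lower_central_subset]]
  note absorb = rcos_absorb[OF lower_central_subgroup]
  have "?T #> ?F (commutator (x \<otimes> x') y) = ?T #> ?F (u \<otimes> (v \<otimes> w))"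
    unfolding u_def v_def w_def using x y by (simp add: commutator_mult)
  also have "\<dots> = ?T #> (?F u \<otimes> ?F (v \<otimes> w))"
    using u lower_central_antimono vw subgroup.m_closed[OF lower_central_subgroup vw] ys
    by (intro Cons.IH) blast+
  also have "\<dots> = ?T #> ?F (v \<otimes> w)" by (rule absorb[OF F(3) Fc(4)])
  also have "\<dots> = ?T #> (?F v \<otimes> ?F w)" by (rule Cons.IH[OF vw ys])
  also have "?F v \<otimes> ?F w = commutator (?F v) (?F w) \<otimes> (?F w \<otimes> ?F v)"
    using Fc by (simp add: commutator_def m_assoc)
  also have "?T #> \<dots> = ?T #> (?F w \<otimes> ?F v)"
    using commutator_lower_central[OF F(1) Fc(2)] Fc by (intro absorb) auto
  finally show ?case by (simp add: v_def w_def)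
qed simp

lemma foldl_commutator_one: "set ys \<subseteq> carrier G \<Longrightarrow> foldl commutator \<one> ys = \<one>"
  by (induction ys) (auto simp: commutator_def)

lemma iterated_commutator_subgroup:
  assumes H: "subgroup H G" and T: "lower_central G (Suc (i + length ys)) \<subseteq> H"
    and ys: "set ys \<subseteq> carrier G"
  shows "subgroup {g \<in> lower_central G i. foldl commutator g ys \<in> H} G"
proof -
  let ?F = "\<lambda>x. foldl commutator x ys"
  note L = lower_central_subgroup[of i]
  have Fc: "?F g \<in> carrier G" if "g \<in> lower_central G i" for g
    using iterated_commutator_mem[OF that ys] lower_central_subset by blast
  have mult: "?F (g \<otimes> h) \<in> H \<longleftrightarrow> ?F g \<otimes> ?F h \<in> H"
    if g: "g \<in> lower_central G i" and h: "h \<in> lower_central G i" for g h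
  proof -
    have gh: "g \<otimes> h \<in> lower_central G i" by (rule subgroup.m_closed[OF L g h])
    have "?F (g \<otimes> h) \<otimes> inv (?F g \<otimes> ?F h) \<in> H"
      using iterated_commutator_mult[OF g h ys] T Fc[OF g] Fc[OF h] Fc[OF gh]
        rcos_eq_iff[OF lower_central_subgroup] by blast
    then have "H #> ?F (g \<otimes> h) = H #> (?F g \<otimes> ?F h)"
      using Fc[OF g] Fc[OF h] Fc[OF gh] rcos_eq_iff[OF H] by blast
    then show ?thesis using Fc[OF g] Fc[OF h] Fc[OF gh] H
      by (metis coset_join1 coset_join2 m_closed)
  qed
  show ?thesis
  proof (rule subgroupI)
    show "{g \<in> lower_central G i. ?F g \<in> H} \<subseteq> carrier G" using lower_central_subset by blast
    show "{g \<in> lower_central G i. ?F g \<in> H} \<noteq> {}"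
      using subgroup.one_closed[OF L] subgroup.one_closed[OF H] foldl_commutator_one[OF ys]
      by (auto intro!: exI[of _ \<one>])
  next
    fix a assume "a \<in> {g \<in> lower_central G i. ?F g \<in> H}"
    then have a: "a \<in> lower_central G i" "?F a \<in> H" by auto
    have ia: "inv a \<in> lower_central G i" by (rule subgroup.m_inv_closed[OF L a(1)])
    have "a \<otimes> inv a = \<one>" using a lower_central_subset by (intro r_inv) blast
    then have "?F a \<otimes> ?F (inv a) \<in> H"
      using mult[OF a(1) ia] foldl_commutator_one[OF ys] subgroup.one_closed[OF H] by simp
    then have "inv ?F a \<otimes> (?F a \<otimes> ?F (inv a)) \<in> H"
      using a(2) subgroup.m_closed[OF H] subgroup.m_inv_closed[OF H] by blast
    then show "inv a \<in> {g \<in> lower_central G i. ?F g \<in> H}"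
      using ia Fc[OF a(1)] Fc[OF ia] by simp
  next
    fix a b assume "a \<in> {g \<in> lower_central G i. ?F g \<in> H}" "b \<in> {g \<in> lower_central G i. ?F g \<in> H}"
    then show "a \<otimes> b \<in> {g \<in> lower_central G i. ?F g \<in> H}"
      using mult subgroup.m_closed[OF L] subgroup.m_closed[OF H] by auto
  qed
qed

text \<open>Otherwise all \<open>k\<close>-fold commutators of elements of \<open>G\<close> are in \<open>H\<close>, since those first entries
  for which they are form a subgroup containing \<open>X\<close>.  By induction on \<open>j\<close> the \<open>(k - j)\<close>-fold
  commutators starting in \<open>L\<^sub>j\<close> are in \<open>H\<close> too, because the generators of \<open>L\<^bsub>j+1\<^esub>\<close> are commutators with first
  entry in \<open>L\<^sub>j\<close>.  For \<open>j = k\<close> this says \<open>L\<^sub>k \<subseteq> H\<close>.\<close>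

lemma ex_iterated_commutator_outside:
  assumes H: "subgroup H G" and gen: "generate G X = carrier G"
    and k: "\<not> lower_central G k \<subseteq> H" "lower_central G (Suc k) \<subseteq> H"
  obtains x ys where "x \<in> X" "set ys \<subseteq> carrier G" "length ys = k" "foldl commutator x ys \<notin> H"
proof (rule ccontr)
  assume neg: "\<not> thesis"
  have X: "X \<subseteq> carrier G" unfolding gen[symmetric] by (rule subsetI) (rule generate.incl)
  have *: "j \<le> k \<Longrightarrow> set ys \<subseteq> carrier G \<Longrightarrow> length ys = k - j \<Longrightarrow>
      lower_central G j \<subseteq> {g \<in> lower_central G j. foldl commutator g ys \<in> H}" for j ys
  proof (induction j arbitrary: ys)
    case 0
    have "subgroup {g \<in> lower_central G 0. foldl commutator g ys \<in> H} G"
      using 0 k(2) by (intro iterated_commutator_subgroup[OF H]) auto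
    moreover have "X \<subseteq> {g \<in> lower_central G 0. foldl commutator g ys \<in> H}"
    proof
      fix x assume "x \<in> X"
      then show "x \<in> {g \<in> lower_central G 0. foldl commutator g ys \<in> H}"
        using neg that[of x ys] 0 X by auto
    qed
    ultimately have "generate G X \<subseteq> {g \<in> lower_central G 0. foldl commutator g ys \<in> H}"
      by (intro generate_subgroup_incl)
    then show ?case by (simp add: gen)
  next
    case (Suc j)
    let ?K = "{g \<in> lower_central G (Suc j). foldl commutator g ys \<in> H}"
    have "subgroup ?K G"
      using Suc.prems k(2) by (intro iterated_commutator_subgroup[OF H]) auto
    moreover have "{commutator x y | x y. x \<in> lower_central G j \<and> y \<in> carrier G} \<subseteq> ?K"
    proof
      fix h assume "h \<in> {commutator x y | x y. x \<in> lower_central G j \<and> y \<in> carrier G}"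
      then obtain x y where xy: "x \<in> lower_central G j" "y \<in> carrier G" "h = commutator x y" by blast
      have "foldl commutator x (y # ys) \<in> H"
        using Suc.IH[of "y # ys"] Suc.prems xy by (auto simp: Suc_diff_Suc)
      then show "h \<in> ?K" using xy commutator_lower_central by simp
    qed
    ultimately show ?case
      using generate_subgroup_incl[of _ ?K] unfolding lower_central_Suc by blast
  qed
  show False using *[of k "[]"] k(1) by auto
qed

lemma mem_normalizerI:
  assumes H: "H \<subseteq> carrier G" and g: "g \<in> carrier G"
    and "\<And>h. h \<in> H \<Longrightarrow> g \<otimes> h \<otimes> inv g \<in> H" "\<And>h. h \<in> H \<Longrightarrow> inv g \<otimes> h \<otimes> g \<in> H"
  shows "g \<in> normalizer G H"
proof -
  have "g <# H #> inv g = H"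
  proof
    show "g <# H #> inv g \<subseteq> H" using assms(3) by (auto simp: l_coset_def r_coset_def)
    show "H \<subseteq> g <# H #> inv g"
    proof
      fix h assume h: "h \<in> H"
      then have "h = g \<otimes> (inv g \<otimes> h \<otimes> g) \<otimes> inv g" using g H by (auto simp: m_assoc)
      then show "h \<in> g <# H #> inv g"
        using assms(4)[OF h] unfolding l_coset_def r_coset_def by blast
    qed
  qed
  then show ?thesis using g H by (simp add: normalizer_def stabilizer_def)
qed

text \<open>\<open>g \<otimes> h \<otimes> inv g = [g, h] \<otimes> h\<close>, and \<open>[g, h]\<close> lies in the next term.\<close>

lemma lower_central_normalizes:
  assumes H: "subgroup H G" and L: "lower_central G (Suc k) \<subseteq> H"
  shows "lower_central G k \<subseteq> normalizer G H"
proof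
  fix g assume g: "g \<in> lower_central G k"
  have conj: "g \<otimes> h \<otimes> inv g \<in> H" if "g \<in> lower_central G k" "h \<in> H" for g h
  proof -
    have gh: "g \<in> carrier G" "h \<in> carrier G"
      using that lower_central_subset subgroup.subset[OF H] by auto
    have "commutator g h \<otimes> h \<in> H"
      using commutator_lower_central[OF that(1) gh(2)] L that(2) subgroup.m_closed[OF H] by blast
    then show ?thesis using gh by (simp add: commutator_def m_assoc)
  qed
  have gc: "g \<in> carrier G" using g lower_central_subset by blast
  have "inv g \<in> lower_central G k" by (rule subgroup.m_inv_closed[OF lower_central_subgroup g])
  then show "g \<in> normalizer G H"
    using conj[OF g] conj[of "inv g"] gc by (intro mem_normalizerI subgroup.subset[OF H]) auto
qed

end

lemma (in fmr) definable_term_iterated_commutator: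
  "definable_term t \<Longrightarrow> set ys \<subseteq> carrier G \<Longrightarrow> definable_term (\<lambda>e. foldl commutator (t e) ys)"
proof (induction ys arbitrary: t)
  case (Cons y ys)
  have "definable_term (\<lambda>e. commutator (t e) y)"
    unfolding commutator_def using Cons.prems
    by (intro definable_term_mult definable_term_inv definable_term_const) auto
  from Cons.IH[OF this] show ?case using Cons.prems by simp
qed simp

section \<open>The normalizer condition\<close>

theorem lemma2p4:
  fixes S :: "('a, 'r, 'c) induced_structure"
    and G :: "('c, 'm) monoid_scheme"
    and r :: int
    and H :: "'c set"
  assumes "U0_group S r G"
    and "nilpotent G"
    and "def_subgroup S G H"
    and "H \<subset> carrier G"
  shows "U0 (quotient_structure S G (normalizer G H) H) r (G\<lparr>carrier := normalizer G H\<rparr> Mod H)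
           \<noteq> {\<one>\<^bsub>G\<lparr>carrier := normalizer G H\<rparr> Mod H\<^esub>}"
proof -
  interpret fmr S G using assms(1) by unfold_locales (simp add: U0_group_def)
  have H: "subgroup H G" using assms(3) by (rule def_subgroupD)
  obtain n where "lower_central G n = {\<one>\<^bsub>G\<^esub>}" using assms(2) by (auto simp: nilpotent_def)
  then have n: "lower_central G n \<subseteq> H" using subgroup.one_closed[OF H] by simp
  have "\<exists>k. \<not> lower_central G k \<subseteq> H \<and> lower_central G (Suc k) \<subseteq> H"
  proof (rule ccontr)
    assume *: "\<not> ?thesis"
    have "\<not> lower_central G i \<subseteq> H" for i using * assms(4) by (induction i) auto
    then show False using n by blast
  qed
  then obtain k where k: "\<not> lower_central G k \<subseteq> H" "lower_central G (Suc k) \<subseteq> H" by blast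
  have "generate G (\<Union>{A. U0_generator S r G A}) = carrier G"
    using assms(1) by (simp add: U0_group_def U0_eq)
  \<comment> \<open>The same \<open>ys\<close> serve all elements of \<open>A\<close>; the element \<open>a\<close> only shows nontriviality.\<close>
  then obtain a ys where "a \<in> \<Union>{A. U0_generator S r G A}" and ys: "set ys \<subseteq> carrier G" "length ys = k"
    and outside: "foldl commutator a ys \<notin> H"
    by (rule ex_iterated_commutator_outside[OF H _ k])
  then obtain A where A: "U0_generator S r G A" and "a \<in> A" by blast
  note a = this(2) outside
  have Ac: "A \<subseteq> carrier G" using A def_subgroup_subset by (auto simp: U0_generator_def)
  have N: "lower_central G k \<subseteq> normalizer G H" by (rule lower_central_normalizes[OF H k(2)])
  have mem: "foldl commutator b ys \<in> lower_central G k" if "b \<in> A" for b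
    using iterated_commutator_mem[of b 0 ys] that Ac ys by auto
  interpret P: fmr_section_hom S G "normalizer G H" H r A "\<lambda>b. foldl commutator b ys"
  proof (intro fmr_section_hom.intro fmr_section.intro fmr_section_axioms.intro
      fmr_section_hom_axioms.intro fmr_axioms)
    show "subgroup (normalizer G H) G" by (rule normalizer_imp_subgroup[OF subgroup.subset[OF H]])
    show "H \<lhd> G\<lparr>carrier := normalizer G H\<rparr>" by (rule subgroup_in_normalizer[OF H])
    show "definable_term (\<lambda>e. foldl commutator (e 0) ys)"
      by (rule definable_term_iterated_commutator[OF definable_term_var ys(1)])
    show "foldl commutator b ys \<in> normalizer G H" if "b \<in> A" for b using mem[OF that] N by blast
    show "H #>\<^bsub>G\<^esub> foldl commutator (b \<otimes>\<^bsub>G\<^esub> c) ys = H #>\<^bsub>G\<^esub> (foldl commutator b ys \<otimes>\<^bsub>G\<^esub> foldl commutator c ys)"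
      if bc: "b \<in> A" "c \<in> A" for b c
    proof -
      have bcA: "b \<otimes>\<^bsub>G\<^esub> c \<in> A"
        using A bc subgroup.m_closed def_subgroupD(1) unfolding U0_generator_def by metis
      note closed = mem[THEN subsetD[OF lower_central_subset]]
      have "lower_central G (Suc k) #>\<^bsub>G\<^esub> foldl commutator (b \<otimes>\<^bsub>G\<^esub> c) ys =
          lower_central G (Suc k) #>\<^bsub>G\<^esub> (foldl commutator b ys \<otimes>\<^bsub>G\<^esub> foldl commutator c ys)"
        using iterated_commutator_mult[of b 0 c ys] bc Ac ys by auto
      then show ?thesis
        using closed[OF bc(1)] closed[OF bc(2)] closed[OF bcA] k(2)
        by (simp add: rcos_eq_iff[OF H] rcos_eq_iff[OF lower_central_subgroup] subset_iff)
    qed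
  qed (use A a assms(3) in auto)
  have "P.f ` A \<subseteq> U0 P.SQ r P.Q"
    using P.U0_generator_image unfolding U0_eq by (auto intro: generate.incl)
  moreover have "P.f ` A \<noteq> {\<one>\<^bsub>P.Q\<^esub>}" "P.f ` A \<noteq> {}"
    using P.U0_generator_image a(1) unfolding U0_generator_def by auto
  ultimately show ?thesis by blast
qed

end
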